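(* Let $\pi:X\to Y$ be a 1-block factor code from a shift of finite type $X$ to a sofic shift $Y$. Let $\nu$ be an ergodic measure on $Y$. Then $$|\mathscr{C}_\pi(y)|\le\min\{N_\nu(\tilde\pi): (X,Y,\pi)\cong(\tilde X,\tilde Y,\tilde\pi),\ \tilde\pi\text{ is 1-block}\},$$ where $y$ is a $\nu$-generic point of $Y$. Equality holds if $\pi$ is finite-to-one and $\nu$ is fully supported.
   Context: All shift spaces are one-dimensional, two-sided, over finite alphabets; $\mathcal{A}(X)$ is the alphabet of $X$. A factor triple $(X,Y,\pi)$ consists of a shift of finite type $X$, a sofic shift $Y$ and a factor code (surjective continuous shift-commuting map) $\pi:X\to Y$. Write $(X,Y,\pi)\cong(\tilde X,\tilde Y,\tilde\pi)$, and call the two factor triples conjugate, if there are conjugacies (shift-commuting homeomorphisms) $\phi:X\to\tilde X$ and $\psi:Y\to\tilde Y$ with $\tilde\pi\circ\phi=\psi\circ\pi$. A factor code $\pi$ is 1-block if $\pi(x)_i=\pi_{\mathrm b}(x_i)$ for all $i$, for a symbol map $\pi_{\mathrm b}:\mathcal{A}(X)\to\mathcal{A}(Y)$. It is finite-to-one if each point of $Y$ has finitely many preimages (there is then a uniform upper bound on the number of preimages). For a 1-block factor code $\pi:X\to Y$ and an ergodic measure $\nu$ on $Y$, $N_\nu(\pi)=\min\{|\pi_{\mathrm b}^{-1}(w)|: w\in\mathcal{A}(Y),\ \nu[w]>0\}$, where $[w]$ is the cylinder set of points with symbol $w$ at coordinate $0$. For a conjugate triple $(\tilde X,\tilde Y,\tilde\pi)$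 with $\tilde\pi$ 1-block and conjugacy $\psi:Y\to\tilde Y$, $N_\nu(\tilde\pi)$ is computed with the corresponding measure $\nu\circ\psi^{-1}$ on $\tilde Y$. For $x,x'\in X$ write $x\to x'$ if for each integer $n$ there is $v\in X$ with $\pi(v)=\pi(x)=\pi(x')$, $v_j=x_j$ for all $j\le n$, and, for some $i\ge n$, $v_j=x'_j$ for all $j\ge i$. Write $x\sim x'$ if $x\to x'$ and $x'\to x$; this is an equivalence relation whose classes are called transition classes. $\mathscr{C}_\pi(y)$ is the set of transition classes contained in $\pi^{-1}(y)$. Ergodic measures are ergodic shift-invariant Borel probability measures; $\nu$ is fully supported if every nonempty open subset of $Y$ has positive $\nu$-measure. A point $y$ is $\nu$-generic if its forward ergodic averages of every continuous function converge to the $\nu$-integral of that function.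
   Formalization: The minimum is taken only over conjugate triples whose domain X̃ is a 1-step shift of finite type; with arbitrary X̃ the claim fails (two tagged copies of the golden mean shift, with the tags of the symbol 1 erased, give two classes but count 1). *)

theory Defs
  imports "HOL-Probability.Probability"
begin

text \<open>
  Points are bi-infinite sequences. An alphabet is a finite set of symbols inside a symbol type
  that need not itself be finite, so one type (such as \<^typ>\<open>nat\<close>) holds all alphabets up to
  renaming.
\<close>

definition shift :: "(int \<Rightarrow> 'a) \<Rightarrow> (int \<Rightarrow> 'a)" where
  "shift x = (\<lambda>i. x (i + 1))"

definition alphabet :: "(int \<Rightarrow> 'a) set \<Rightarrow> 'a set" where
  "alphabet X = {x i |x i. x \<in> X}"

definition shift_top :: "(int \<Rightarrow> 'a) set \<Rightarrow> (int \<Rightarrow> 'a) topology" where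
  "shift_top X = subtopology (product_topology (\<lambda>_::int. discrete_topology UNIV) UNIV) X"

definition shift_space :: "(int \<Rightarrow> 'a) set \<Rightarrow> bool" where
  "shift_space X \<longleftrightarrow> finite (alphabet X) \<and> closedin (shift_top UNIV) X \<and> shift ` X = X"

definition occurs :: "'a list \<Rightarrow> (int \<Rightarrow> 'a) \<Rightarrow> bool" where
  "occurs w x \<longleftrightarrow> (\<exists>i. \<forall>j<length w. x (i + int j) = w ! j)"

definition avoiding :: "'a set \<Rightarrow> 'a list set \<Rightarrow> (int \<Rightarrow> 'a) set" where
  "avoiding A F = {x. range x \<subseteq> A \<and> (\<forall>w\<in>F. \<not> occurs w x)}"

definition shift_of_finite_type :: "(int \<Rightarrow> 'a) set \<Rightarrow> bool" where
  "shift_of_finite_type X \<longleftrightarrow> (\<exists>A F. finite A \<and> finite F \<and> X = avoiding A F)"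

definition one_step :: "(int \<Rightarrow> 'a) set \<Rightarrow> bool" where
  "one_step X \<longleftrightarrow>
     (\<exists>A F. finite A \<and> finite F \<and> (\<forall>w\<in>F. length w = 2) \<and> X = avoiding A F)"

definition factor_code ::
    "(int \<Rightarrow> 'a) set \<Rightarrow> (int \<Rightarrow> 'b) set \<Rightarrow> ((int \<Rightarrow> 'a) \<Rightarrow> (int \<Rightarrow> 'b)) \<Rightarrow> bool" where
  "factor_code X Y \<pi> \<longleftrightarrow>
     continuous_map (shift_top X) (shift_top Y) \<pi> \<and> \<pi> ` X = Y \<and>
     (\<forall>x\<in>X. \<pi> (shift x) = shift (\<pi> x))"

text \<open>The covering shift of finite type may be taken over an alphabet of natural numbers.\<close>

definition sofic :: "(int \<Rightarrow> 'b) set \<Rightarrow> bool" where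
  "sofic Y \<longleftrightarrow> shift_space Y \<and>
     (\<exists>(Z :: (int \<Rightarrow> nat) set) \<rho>. shift_of_finite_type Z \<and> factor_code Z Y \<rho>)"

definition factor_triple ::
    "(int \<Rightarrow> 'a) set \<Rightarrow> (int \<Rightarrow> 'b) set \<Rightarrow> ((int \<Rightarrow> 'a) \<Rightarrow> (int \<Rightarrow> 'b)) \<Rightarrow> bool" where
  "factor_triple X Y \<pi> \<longleftrightarrow> shift_of_finite_type X \<and> sofic Y \<and> factor_code X Y \<pi>"

definition conjugacy ::
    "(int \<Rightarrow> 'a) set \<Rightarrow> (int \<Rightarrow> 'b) set \<Rightarrow> ((int \<Rightarrow> 'a) \<Rightarrow> (int \<Rightarrow> 'b)) \<Rightarrow> bool" where
  "conjugacy X X' \<phi> \<longleftrightarrow>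
     homeomorphic_map (shift_top X) (shift_top X') \<phi> \<and> (\<forall>x\<in>X. \<phi> (shift x) = shift (\<phi> x))"

definition conjugate_triples_via ::
    "(int \<Rightarrow> 'a) set \<Rightarrow> (int \<Rightarrow> 'b) set \<Rightarrow> ((int \<Rightarrow> 'a) \<Rightarrow> (int \<Rightarrow> 'b)) \<Rightarrow>
     (int \<Rightarrow> 'c) set \<Rightarrow> (int \<Rightarrow> 'd) set \<Rightarrow> ((int \<Rightarrow> 'c) \<Rightarrow> (int \<Rightarrow> 'd)) \<Rightarrow>
     ((int \<Rightarrow> 'a) \<Rightarrow> (int \<Rightarrow> 'c)) \<Rightarrow> ((int \<Rightarrow> 'b) \<Rightarrow> (int \<Rightarrow> 'd)) \<Rightarrow> bool" where
  "conjugate_triples_via X Y \<pi> X' Y' \<pi>' \<phi> \<psi> \<longleftrightarrow>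
     factor_triple X Y \<pi> \<and> factor_triple X' Y' \<pi>' \<and>
     conjugacy X X' \<phi> \<and> conjugacy Y Y' \<psi> \<and> (\<forall>x\<in>X. \<pi>' (\<phi> x) = \<psi> (\<pi> x))"

text \<open>The symbol map \<open>pb\<close> is determined by \<open>\<pi>\<close> on the alphabet of \<open>X\<close>, the only place it is used.\<close>

definition symbol_map ::
    "(int \<Rightarrow> 'a) set \<Rightarrow> ((int \<Rightarrow> 'a) \<Rightarrow> (int \<Rightarrow> 'b)) \<Rightarrow> ('a \<Rightarrow> 'b) \<Rightarrow> bool" where
  "symbol_map X \<pi> pb \<longleftrightarrow> (\<forall>x\<in>X. \<forall>i. \<pi> x i = pb (x i))"

definition one_block :: "(int \<Rightarrow> 'a) set \<Rightarrow> ((int \<Rightarrow> 'a) \<Rightarrow> (int \<Rightarrow> 'b)) \<Rightarrow> bool" where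
  "one_block X \<pi> \<longleftrightarrow> (\<exists>pb. symbol_map X \<pi> pb)"

definition finite_to_one ::
    "(int \<Rightarrow> 'a) set \<Rightarrow> (int \<Rightarrow> 'b) set \<Rightarrow> ((int \<Rightarrow> 'a) \<Rightarrow> (int \<Rightarrow> 'b)) \<Rightarrow> bool" where
  "finite_to_one X Y \<pi> \<longleftrightarrow> (\<forall>y\<in>Y. finite {x\<in>X. \<pi> x = y})"

definition shift_borel :: "(int \<Rightarrow> 'a) set \<Rightarrow> (int \<Rightarrow> 'a) measure" where
  "shift_borel X = sigma X {U. openin (shift_top X) U}"

definition ergodic_measure :: "(int \<Rightarrow> 'a) set \<Rightarrow> (int \<Rightarrow> 'a) measure \<Rightarrow> bool" where
  "ergodic_measure X \<mu> \<longleftrightarrow>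
     prob_space \<mu> \<and> space \<mu> = X \<and> sets \<mu> = sets (shift_borel X) \<and>
     shift \<in> measurable \<mu> \<mu> \<and> distr \<mu> \<mu> shift = \<mu> \<and>
     (\<forall>B\<in>sets \<mu>. shift -` B \<inter> X = B \<longrightarrow> measure \<mu> B = 0 \<or> measure \<mu> B = 1)"

definition fully_supported :: "(int \<Rightarrow> 'a) set \<Rightarrow> (int \<Rightarrow> 'a) measure \<Rightarrow> bool" where
  "fully_supported X \<mu> \<longleftrightarrow> (\<forall>U. openin (shift_top X) U \<and> U \<noteq> {} \<longrightarrow> measure \<mu> U > 0)"

definition generic_point ::
    "(int \<Rightarrow> 'a) set \<Rightarrow> (int \<Rightarrow> 'a) measure \<Rightarrow> (int \<Rightarrow> 'a) \<Rightarrow> bool" where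
  "generic_point X \<mu> x \<longleftrightarrow> x \<in> X \<and>
     (\<forall>f :: (int \<Rightarrow> 'a) \<Rightarrow> real. continuous_map (shift_top X) euclideanreal f \<longrightarrow>
        (\<lambda>n. (\<Sum>k<n. f ((shift ^^ k) x)) / real n) \<longlonglongrightarrow> integral\<^sup>L \<mu> f)"

definition cylinder :: "(int \<Rightarrow> 'a) set \<Rightarrow> 'a \<Rightarrow> (int \<Rightarrow> 'a) set" where
  "cylinder X w = {x\<in>X. x 0 = w}"

definition N_measure ::
    "(int \<Rightarrow> 'a) set \<Rightarrow> (int \<Rightarrow> 'b) set \<Rightarrow> (int \<Rightarrow> 'b) measure \<Rightarrow> ('a \<Rightarrow> 'b) \<Rightarrow> nat" where
  "N_measure X Y \<nu> pb =
     Min {card {a \<in> alphabet X. pb a = w} |w. w \<in> alphabet Y \<and> measure \<nu> (cylinder Y w) > 0}"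

text \<open>
  The minimum over all conjugate triples with a 1-block code and all conjugacies onto them. Every
  triple over finite alphabets is, up to renaming symbols (which does not affect the counts), one
  over natural numbers. The set is infinite in general, so its least element is taken with \<open>Inf\<close>;
  it is nonempty for every factor triple, by passing to a higher block presentation.

  As usual for symbol counts of 1-block codes, the domain \<open>X'\<close> is presented as a 1-step shift of
  finite type. Without this the counts do not bound the number of transition classes: let \<open>Y\<close> be
  the golden mean shift (no \<open>11\<close>), \<open>X\<close> the disjoint union of two tagged copies of \<open>Y\<close>, and \<open>X'\<close>
  obtained from \<open>X\<close> by erasing the tags of the symbols \<open>1\<close>. The tag of a \<open>1\<close> is that of its
  neighbours, so \<open>X'\<close> is a (2-step) shift of finite type conjugate to \<open>X\<close> over \<open>Y\<close>, and the symbol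
  \<open>1\<close> has a single preimage, although every point of \<open>Y\<close> has two transition classes over it.
\<close>

definition min_N ::
    "(int \<Rightarrow> 'a) set \<Rightarrow> (int \<Rightarrow> 'b) set \<Rightarrow> ((int \<Rightarrow> 'a) \<Rightarrow> (int \<Rightarrow> 'b)) \<Rightarrow> (int \<Rightarrow> 'b) measure \<Rightarrow> nat"
  where
  "min_N X Y \<pi> \<nu> =
     Inf {N_measure X' Y' (distr \<nu> (shift_borel Y') \<psi>) pb
          |(X' :: (int \<Rightarrow> nat) set) (Y' :: (int \<Rightarrow> nat) set) \<pi>' pb \<phi> \<psi>.
             conjugate_triples_via X Y \<pi> X' Y' \<pi>' \<phi> \<psi> \<and>
             one_step X' \<and> symbol_map X' \<pi>' pb}"

definition transition ::
    "(int \<Rightarrow> 'a) set \<Rightarrow> ((int \<Rightarrow> 'a) \<Rightarrow> (int \<Rightarrow> 'b)) \<Rightarrow> (int \<Rightarrow> 'a) \<Rightarrow> (int \<Rightarrow> 'a) \<Rightarrow> bool" where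
  "transition X \<pi> x x' \<longleftrightarrow>
     (\<forall>n::int. \<exists>v\<in>X. \<pi> v = \<pi> x \<and> \<pi> x = \<pi> x' \<and>
        (\<forall>j\<le>n. v j = x j) \<and> (\<exists>i\<ge>n. \<forall>j\<ge>i. v j = x' j))"

definition transition_rel ::
    "(int \<Rightarrow> 'a) set \<Rightarrow> ((int \<Rightarrow> 'a) \<Rightarrow> (int \<Rightarrow> 'b)) \<Rightarrow> (int \<Rightarrow> 'a) rel" where
  "transition_rel X \<pi> =
     {(x, x'). x \<in> X \<and> x' \<in> X \<and> transition X \<pi> x x' \<and> transition X \<pi> x' x}"

definition transition_classes ::
    "(int \<Rightarrow> 'a) set \<Rightarrow> ((int \<Rightarrow> 'a) \<Rightarrow> (int \<Rightarrow> 'b)) \<Rightarrow> (int \<Rightarrow> 'b) \<Rightarrow> (int \<Rightarrow> 'a) set set" where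
  "transition_classes X \<pi> y = {C \<in> X // transition_rel X \<pi>. C \<subseteq> {x\<in>X. \<pi> x = y}}"

end

theory Submission
  imports Defs
begin

text \<open>
  Every shift of finite type involved is compact, and membership in it is tested on windows of a
  bounded length, so two points that agree on a long enough interval can be spliced there.

  \<^bold>\<open>Upper bound.\<close> Sliding block codes preserve transitions, so the classes over \<open>y\<close> may be
  counted in any conjugate triple. Take a 1-step one and a symbol \<open>w\<close> of positive measure with the
  fewest preimages. Since \<open>y\<close> is generic, \<open>w\<close> occurs infinitely often to the right
  (\<open>generic_recurrent\<close>). Two points over \<open>y\<close> that show the same symbol at arbitrarily late times
  can be spliced at each of these times, in both directions, hence lie in one class
  (\<open>one_step_transition\<close>). So at a late occurrence of \<open>w\<close> inequivalent points show different
  symbols over \<open>w\<close>, and there are at most as many classes as such symbols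
  (\<open>card_transition_classes_le\<close>).

  \<^bold>\<open>Equality.\<close> If the fiber of \<open>y\<close> is finite, then among the witnesses of \<open>x \<rightarrow> x'\<close> only
  \<open>x\<close> itself can follow \<open>x\<close> for long, so \<open>x \<rightarrow> x'\<close> means that the two points agree from some
  coordinate on (\<open>transition_right_asymptotic\<close>). Far enough to the right, at \<open>i\<close> say, the fiber
  therefore shows at most one window \<open>x[i, i + L]\<close> for each class. By compactness a long block of
  \<open>y\<close> around \<open>i\<close> admits no windows over it but those of the fiber (\<open>long_block_fiber\<close>). Recoding
  \<open>X\<close> by pairs of such a window and such a block turns the block into a symbol with no more
  preimages than there are classes (\<open>presentation_with_class_many_symbols\<close>), and it has positive
  measure because \<open>\<nu>\<close> is fully supported.
\<close>

section \<open>The topology and measurable structure of a shift space\<close>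

definition agree :: "nat \<Rightarrow> (int \<Rightarrow> 'a) \<Rightarrow> (int \<Rightarrow> 'a) \<Rightarrow> bool" where
  "agree m x x' \<longleftrightarrow> (\<forall>j. \<bar>j\<bar> \<le> int m \<longrightarrow> x j = x' j)"

lemma agree_mono: "agree n x x' \<Longrightarrow> m \<le> n \<Longrightarrow> agree m x x'"
  unfolding agree_def by (metis of_nat_mono order_trans)

lemma agree_trans: "agree m x x' \<Longrightarrow> agree m x' x'' \<Longrightarrow> agree m x x''"
  unfolding agree_def by simp

lemma agree_refl [simp]: "agree m x x"
  unfolding agree_def by simp

lemma topspace_shift_top [simp]: "topspace (shift_top X) = X"
  unfolding shift_top_def by simp

lemma openin_shift_top:
  "openin (shift_top X) U \<longleftrightarrow>
     U \<subseteq> X \<and> (\<forall>x\<in>U. \<exists>m. \<forall>x'\<in>X. agree m x x' \<longrightarrow> x' \<in> U)"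
proof
  assume "openin (shift_top X) U"
  then obtain T where T: "openin (product_topology (\<lambda>_::int. discrete_topology UNIV) UNIV) T"
    and U: "U = T \<inter> X"
    unfolding shift_top_def openin_subtopology by blast
  show "U \<subseteq> X \<and> (\<forall>x\<in>U. \<exists>m. \<forall>x'\<in>X. agree m x x' \<longrightarrow> x' \<in> U)"
  proof (intro conjI ballI)
    fix x assume "x \<in> U"
    then have "x \<in> T" using U by simp
    then obtain V where fin: "finite {i. V i \<noteq> (UNIV :: 'a set)}"
      and x: "x \<in> Pi\<^sub>E UNIV V" and VT: "Pi\<^sub>E UNIV V \<subseteq> T"
      using T unfolding openin_product_topology_alt by fastforce
    define m where "m = Max (insert 0 ((nat \<circ> abs) ` {i. V i \<noteq> UNIV}))"
    have m: "V i = UNIV" if "\<bar>i\<bar> > int m" for i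
    proof (rule ccontr)
      assume "V i \<noteq> UNIV"
      then have "nat \<bar>i\<bar> \<le> m" unfolding m_def using fin by (intro Max_ge) auto
      then show False using that by simp
    qed
    have "x' \<in> U" if "x' \<in> X" "agree m x x'" for x'
    proof -
      have "x' i \<in> V i" for i
      proof (cases "\<bar>i\<bar> \<le> int m")
        case True
        then have "x' i = x i" using that(2) unfolding agree_def by simp
        then show ?thesis using x by (auto simp: PiE_iff)
      next
        case False
        then show ?thesis using m by simp
      qed
      then show ?thesis using VT U that(1) by auto
    qed
    then show "\<exists>m. \<forall>x'\<in>X. agree m x x' \<longrightarrow> x' \<in> U" by blast
  qed (use U in auto)
next
  assume U: "U \<subseteq> X \<and> (\<forall>x\<in>U. \<exists>m. \<forall>x'\<in>X. agree m x x' \<longrightarrow> x' \<in> U)"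
  \<comment> \<open>The union of the central cylinders around points of \<open>U\<close> that meet \<open>X\<close> only inside \<open>U\<close>.\<close>
  define T where "T = {z. \<exists>x\<in>U. \<exists>m. (\<forall>x'\<in>X. agree m x x' \<longrightarrow> x' \<in> U) \<and> agree m x z}"
  have "openin (product_topology (\<lambda>_::int. discrete_topology UNIV) UNIV) T"
    unfolding openin_product_topology_alt
  proof
    fix z assume "z \<in> T"
    then obtain x m where xm: "x \<in> U" "\<forall>x'\<in>X. agree m x x' \<longrightarrow> x' \<in> U" "agree m x z"
      unfolding T_def by blast
    define V where "V = (\<lambda>j. if \<bar>j\<bar> \<le> int m then {z j} else UNIV)"
    have "{i. V i \<noteq> UNIV} \<subseteq> {-int m..int m}" unfolding V_def by (auto split: if_splits)
    then have "finite {i. V i \<noteq> UNIV}" by (rule finite_subset) simp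
    moreover have "Pi\<^sub>E UNIV V \<subseteq> T"
    proof
      fix z' assume "z' \<in> Pi\<^sub>E UNIV V"
      then have "\<And>j. z' j \<in> V j" by (auto simp: PiE_iff)
      then have "agree m z z'" unfolding agree_def V_def
        by (metis singletonD)
      then show "z' \<in> T" using xm agree_trans unfolding T_def by blast
    qed
    ultimately show "\<exists>V. finite {i \<in> UNIV. V i \<noteq> topspace (discrete_topology UNIV)} \<and>
      (\<forall>i\<in>UNIV. openin (discrete_topology UNIV) (V i)) \<and> z \<in> Pi\<^sub>E UNIV V \<and> Pi\<^sub>E UNIV V \<subseteq> T"
      by (intro exI[of _ V]) (auto simp: V_def)
  qed
  moreover have "U = T \<inter> X"
  proof
    show "U \<subseteq> T \<inter> X"
    proof
      fix x assume "x \<in> U"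
      then obtain m where "\<forall>x'\<in>X. agree m x x' \<longrightarrow> x' \<in> U" using U by blast
      then have "x \<in> T" unfolding T_def using \<open>x \<in> U\<close> agree_refl by blast
      then show "x \<in> T \<inter> X" using \<open>x \<in> U\<close> U by blast
    qed
  qed (auto simp: T_def)
  ultimately show "openin (shift_top X) U"
    unfolding shift_top_def openin_subtopology by blast
qed

lemma Hausdorff_shift_top: "Hausdorff_space (shift_top X)"
  unfolding shift_top_def
  by (intro Hausdorff_space_subtopology) (simp add: Hausdorff_space_product_topology)

lemma compact_shift_top:
  assumes "finite (alphabet X)" "closedin (shift_top UNIV) X"
  shows "compact_space (shift_top X)"
proof -
  have "compactin (shift_top UNIV) (Pi\<^sub>E UNIV (\<lambda>_. alphabet X))"
    unfolding shift_top_def using assms(1)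
    by (simp add: compactin_PiE finite_imp_compactin_eq)
  moreover have "X \<subseteq> Pi\<^sub>E UNIV (\<lambda>_. alphabet X)"
    unfolding alphabet_def by auto
  ultimately have "compactin (shift_top UNIV) X"
    using assms(2) closed_compactin by blast
  then show ?thesis
    unfolding shift_top_def by (simp add: compact_space_subtopology)
qed

text \<open>
  Compactness in the form in which it is applied below: the points satisfying \<open>P m\<close> form an open
  set that grows with \<open>m\<close>, and these sets cover the space, so one of them is the whole space.
\<close>

lemma compact_exhaustion:
  assumes comp: "compact_space (shift_top X)"
    and loc: "\<And>m x. x \<in> X \<Longrightarrow> P m x \<Longrightarrow> \<exists>k. \<forall>x'\<in>X. agree k x x' \<longrightarrow> P m x'"
    and mono: "\<And>m n x. P m x \<Longrightarrow> m \<le> n \<Longrightarrow> P n x"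
    and ex: "\<And>x. x \<in> X \<Longrightarrow> \<exists>m::nat. P m x"
  shows "\<exists>m. \<forall>x\<in>X. P m x"
proof -
  define U where "U m = {x\<in>X. P m x}" for m
  have "\<exists>\<F>. finite \<F> \<and> \<F> \<subseteq> range U \<and> X \<subseteq> \<Union>\<F>"
  proof -
    have "openin (shift_top X) (U m)" for m
      unfolding openin_shift_top U_def using loc by auto
    moreover have "X \<subseteq> \<Union>(range U)" unfolding U_def using ex by auto
    ultimately show ?thesis
      using comp[unfolded compact_space_alt, rule_format, of "range U"] by auto
  qed
  then obtain I where I: "finite I" "X \<subseteq> \<Union>(U ` I)"
    by (metis finite_subset_image)
  have "P (Max (insert 0 I)) x" if x: "x \<in> X" for x
  proof -
    obtain m where "m \<in> I" "P m x" using I(2) x unfolding U_def by blast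
    then show ?thesis using mono I(1) by (metis Max_ge finite_insert insertI2)
  qed
  then show ?thesis by blast
qed

lemma continuous_shift_top:
  "continuous_map (shift_top X) (shift_top Y) f \<longleftrightarrow>
     f ` X \<subseteq> Y \<and> (\<forall>x\<in>X. \<forall>i. \<exists>m. \<forall>x'\<in>X. agree m x x' \<longrightarrow> f x i = f x' i)"
proof
  assume f: "continuous_map (shift_top X) (shift_top Y) f"
  show "f ` X \<subseteq> Y \<and> (\<forall>x\<in>X. \<forall>i. \<exists>m. \<forall>x'\<in>X. agree m x x' \<longrightarrow> f x i = f x' i)"
  proof (intro conjI ballI allI)
    show *: "f ` X \<subseteq> Y" using f continuous_map_image_subset_topspace by fastforce
    fix x i assume x: "x \<in> X"
    have "openin (shift_top Y) {z\<in>Y. z i = f x i}"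
      unfolding openin_shift_top by (auto simp: agree_def intro!: exI[of _ "nat \<bar>i\<bar>"])
    then have "openin (shift_top X) {x'\<in>X. f x' \<in> {z\<in>Y. z i = f x i}}"
      using f openin_continuous_map_preimage by fastforce
    moreover have "x \<in> {x'\<in>X. f x' \<in> {z\<in>Y. z i = f x i}}" using x * by auto
    ultimately obtain m
      where "\<forall>x'\<in>X. agree m x x' \<longrightarrow> x' \<in> {x'\<in>X. f x' \<in> {z\<in>Y. z i = f x i}}"
      unfolding openin_shift_top by meson
    then show "\<exists>m. \<forall>x'\<in>X. agree m x x' \<longrightarrow> f x i = f x' i" by force
  qed
next
  assume *: "f ` X \<subseteq> Y \<and> (\<forall>x\<in>X. \<forall>i. \<exists>m. \<forall>x'\<in>X. agree m x x' \<longrightarrow> f x i = f x' i)"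
  show "continuous_map (shift_top X) (shift_top Y) f"
    unfolding continuous_map_def
  proof (intro conjI allI impI)
    fix U assume "openin (shift_top Y) U"
    then have U: "\<And>z. z \<in> U \<Longrightarrow> \<exists>k. \<forall>z'\<in>Y. agree k z z' \<longrightarrow> z' \<in> U"
      unfolding openin_shift_top by blast
    have "\<exists>n. \<forall>x'\<in>X. agree n x x' \<longrightarrow> f x' \<in> U" if "x \<in> X" and fx: "f x \<in> U" for x
    proof -
      obtain k where k: "\<And>z'. z' \<in> Y \<Longrightarrow> agree k (f x) z' \<Longrightarrow> z' \<in> U" using U[OF fx] by blast
      have "\<forall>i. \<exists>m. \<forall>x'\<in>X. agree m x x' \<longrightarrow> f x i = f x' i" using * \<open>x \<in> X\<close> by blast
      from choice[OF this] obtain m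
        where m: "\<And>i x'. x' \<in> X \<Longrightarrow> agree (m i) x x' \<Longrightarrow> f x i = f x' i"
        by blast
      define n where "n = Max (m ` {-int k..int k})"
      have n: "m i \<le> n" if "\<bar>i\<bar> \<le> int k" for i
        unfolding n_def using that by (intro Max_ge imageI) auto
      have "f x' \<in> U" if "x' \<in> X" "agree n x x'" for x'
      proof (rule k)
        show "f x' \<in> Y" using * that by auto
        show "agree k (f x) (f x')"
          unfolding agree_def using m[OF that(1)] agree_mono[OF that(2) n] by blast
      qed
      then show ?thesis by blast
    qed
    then show "openin (shift_top X) {x \<in> topspace (shift_top X). f x \<in> U}"
      unfolding openin_shift_top by auto
  qed (use * in auto)
qed

lemma space_shift_borel: "space (shift_borel X) = X"
  unfolding shift_borel_def by (rule space_measure_of_conv)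

lemma openin_sets_shift_borel:
  assumes "openin (shift_top X) U" shows "U \<in> sets (shift_borel X)"
proof -
  have "{U. openin (shift_top X) U} \<subseteq> Pow X" using openin_subset by fastforce
  then show ?thesis using assms unfolding shift_borel_def by (simp add: sets_measure_of)
qed

lemma continuous_measurable:
  assumes "continuous_map (shift_top X) (shift_top Y) f"
    and "sets \<nu> = sets (shift_borel X)"
  shows "f \<in> measurable \<nu> (shift_borel Y)"
proof -
  have "space \<nu> = X" using assms(2) sets_eq_imp_space_eq space_shift_borel by blast
  show ?thesis
    unfolding shift_borel_def
  proof (rule measurable_measure_of)
    show "{U. openin (shift_top Y) U} \<subseteq> Pow Y" using openin_subset by fastforce
    show "f \<in> space \<nu> \<rightarrow> Y"
      using assms(1) \<open>space \<nu> = X\<close> unfolding continuous_shift_top by auto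
    fix U assume "U \<in> {U. openin (shift_top Y) U}"
    then have "openin (shift_top X) {x\<in>X. f x \<in> U}"
      using assms(1) openin_continuous_map_preimage by fastforce
    moreover have "{x\<in>X. f x \<in> U} = f -` U \<inter> space \<nu>" using \<open>space \<nu> = X\<close> by auto
    ultimately show "f -` U \<inter> space \<nu> \<in> sets \<nu>"
      using assms(2) openin_sets_shift_borel by metis
  qed
qed

lemma openin_cylinder: "openin (shift_top X) (cylinder X w)"
  unfolding openin_shift_top cylinder_def by (auto simp: agree_def intro!: exI[of _ 0])

section \<open>Shift-commuting maps and windows\<close>

lemma translate_mem:
  assumes "shift ` X = X" "x \<in> X"
  shows "(\<lambda>i. x (i + k)) \<in> X"
proof (induction k rule: int_induct[where k = 0])
  case (step1 k)
  then have "shift (\<lambda>i. x (i + k)) \<in> X" using assms(1) by blast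
  then show ?case by (simp add: shift_def algebra_simps)
next
  case (step2 k)
  then obtain z where z: "z \<in> X" "shift z = (\<lambda>i. x (i + k))" using assms(1) by (metis imageE)
  have "z i = x (i + (k - 1))" for i
    using fun_cong[OF z(2), of "i - 1"] by (simp add: shift_def algebra_simps)
  then have "z = (\<lambda>i. x (i + (k - 1)))" by blast
  then show ?case using z(1) by simp
qed (use assms in simp)

lemma translate_commute:
  assumes "shift ` X = X" "\<And>x. x \<in> X \<Longrightarrow> f (shift x) = shift (f x)" "x \<in> X"
  shows "f (\<lambda>i. x (i + k)) = (\<lambda>i. f x (i + k))"
proof (induction k rule: int_induct[where k = 0])
  case (step1 k)
  have "f (shift (\<lambda>i. x (i + k))) = shift (f (\<lambda>i. x (i + k)))"
    by (intro assms(2) translate_mem assms)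
  then show ?case using step1 by (simp add: shift_def algebra_simps)
next
  case (step2 k)
  have "f (shift (\<lambda>i. x (i + (k - 1)))) = shift (f (\<lambda>i. x (i + (k - 1))))"
    by (intro assms(2) translate_mem assms)
  then have "f (\<lambda>i. x (i + k)) = shift (f (\<lambda>i. x (i + (k - 1))))"
    by (simp add: shift_def algebra_simps)
  then have "(\<lambda>i. f x (i + k)) = shift (f (\<lambda>i. x (i + (k - 1))))" using step2 by simp
  then have "f x (i - 1 + k) = shift (f (\<lambda>i. x (i + (k - 1)))) (i - 1)" for i by metis
  then show ?case by (intro ext) (simp add: shift_def algebra_simps)
qed simp

lemma shift_funpow: "(shift ^^ k) x = (\<lambda>i. x (i + int k))"
  by (induction k) (auto simp: shift_def algebra_simps)

text \<open>
  The Curtis--Hedlund--Lyndon theorem: the zeroth symbol of the image is a continuous function on a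
  compact space with discrete values, hence depends on a bounded window.
\<close>

lemma sliding_block_code:
  assumes comp: "compact_space (shift_top X)" and inv: "shift ` X = X"
    and cont: "continuous_map (shift_top X) (shift_top Y) f"
    and comm: "\<And>x. x \<in> X \<Longrightarrow> f (shift x) = shift (f x)"
  obtains m where "\<And>x x' i. x \<in> X \<Longrightarrow> x' \<in> X \<Longrightarrow>
      (\<And>j. \<bar>j\<bar> \<le> int m \<Longrightarrow> x (i + j) = x' (i + j)) \<Longrightarrow> f x i = f x' i"
proof -
  define P where "P m x \<longleftrightarrow> (\<forall>x'\<in>X. agree m x x' \<longrightarrow> f x 0 = f x' 0)" for m x
  have "\<exists>m. \<forall>x\<in>X. P m x"
  proof (rule compact_exhaustion[OF comp, of P])
    fix m x assume "x \<in> X" "P m x"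
    then show "\<exists>k. \<forall>x'\<in>X. agree k x x' \<longrightarrow> P m x'"
      unfolding P_def by (metis agree_trans)
  next
    fix m n x assume "P m x" "m \<le> n"
    then show "P n x" unfolding P_def using agree_mono by metis
  next
    fix x assume "x \<in> X"
    then show "\<exists>m. P m x" using cont unfolding P_def continuous_shift_top by blast
  qed
  then obtain m where m: "\<And>x. x \<in> X \<Longrightarrow> P m x" by blast
  show thesis
  proof (rule that)
    fix x x' i assume x: "x \<in> X" "x' \<in> X" and eq: "\<And>j. \<bar>j\<bar> \<le> int m \<Longrightarrow> x (i + j) = x' (i + j)"
    have "agree m (\<lambda>j. x (j + i)) (\<lambda>j. x' (j + i))"
      unfolding agree_def using eq by (simp add: add.commute)
    then have "f (\<lambda>j. x (j + i)) 0 = f (\<lambda>j. x' (j + i)) 0"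
      using m translate_mem[OF inv] x unfolding P_def by blast
    then show "f x i = f x' i" using translate_commute[of X f, OF inv comm] x by simp
  qed
qed

text \<open>
  Membership is tested on windows of \<open>L + 1\<close> symbols. Up to the finiteness of the alphabet and
  shift invariance this is finite type, and 1-step is the case \<open>L = 1\<close>; in this form it can be
  checked directly for the image of a block code.
\<close>

definition window_determined :: "nat \<Rightarrow> (int \<Rightarrow> 'a) set \<Rightarrow> bool" where
  "window_determined L X \<longleftrightarrow>
     (\<forall>x. (\<forall>i. \<exists>x'\<in>X. \<forall>j\<in>{0..int L}. x (i + j) = x' (i + j)) \<longrightarrow> x \<in> X)"

lemma window_determined_avoiding:
  assumes "\<And>w. w \<in> F \<Longrightarrow> length w \<le> Suc L"
  shows "window_determined L (avoiding A F)"
  unfolding window_determined_def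
proof (intro allI impI)
  fix x assume x: "\<forall>i. \<exists>x'\<in>avoiding A F. \<forall>j\<in>{0..int L}. x (i + j) = x' (i + j)"
  have "x i \<in> A" for i
  proof -
    obtain x' where x': "x' \<in> avoiding A F" "\<forall>j\<in>{0..int L}. x (i + j) = x' (i + j)"
      using x[THEN spec, of i] by (elim bexE)
    have "x (i + 0) = x' (i + 0)" using x'(2) by (rule bspec) simp
    then show ?thesis using x'(1) by (auto simp: avoiding_def)
  qed
  moreover have "\<not> occurs w x" if w: "w \<in> F" for w
  proof
    assume "occurs w x"
    then obtain i where i: "\<And>j. j < length w \<Longrightarrow> x (i + int j) = w ! j" unfolding occurs_def by blast
    obtain x' where x': "x' \<in> avoiding A F" "\<forall>j\<in>{0..int L}. x (i + j) = x' (i + j)"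
      using x[THEN spec, of i] by (elim bexE)
    have "x' (i + int j) = w ! j" if "j < length w" for j
    proof -
      have "int j \<in> {0..int L}" using assms[OF w] that by simp
      with x'(2) have "x (i + int j) = x' (i + int j)" by (rule bspec)
      then show ?thesis using i[OF that] by simp
    qed
    then have "occurs w x'" unfolding occurs_def by blast
    then show False using x'(1) w unfolding avoiding_def by blast
  qed
  ultimately show "x \<in> avoiding A F" unfolding avoiding_def by auto
qed

lemma occurs_shift [simp]: "occurs w (shift x) \<longleftrightarrow> occurs w x"
proof
  assume "occurs w (shift x)"
  then obtain i where "\<forall>j<length w. x ((i + 1) + int j) = w ! j"
    unfolding occurs_def shift_def by (auto simp: algebra_simps)
  then show "occurs w x" unfolding occurs_def by blast
next
  assume "occurs w x"
  then obtain i where "\<forall>j<length w. x (i + int j) = w ! j" unfolding occurs_def by blast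
  then have "\<forall>j<length w. shift x ((i - 1) + int j) = w ! j"
    unfolding shift_def by (simp add: algebra_simps)
  then show "occurs w (shift x)" unfolding occurs_def by blast
qed

lemma shift_of_finite_type_shift_space:
  assumes "shift_of_finite_type X"
  shows "shift_space X"
proof -
  obtain A F where A: "finite A" and X: "X = avoiding A F"
    using assms unfolding shift_of_finite_type_def by blast
  have "alphabet X \<subseteq> A" unfolding alphabet_def X avoiding_def by auto
  moreover have "closedin (shift_top UNIV) X"
    unfolding closedin_def topspace_shift_top openin_shift_top
  proof (intro conjI ballI)
    fix x assume "x \<in> UNIV - X"
    then consider i where "x i \<notin> A" | w i where "w \<in> F" "\<forall>j<length w. x (i + int j) = w ! j"
      unfolding X avoiding_def occurs_def by auto
    then show "\<exists>m. \<forall>x'\<in>UNIV. agree m x x' \<longrightarrow> x' \<in> UNIV - X"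
    proof cases
      case 1
      have "x' \<notin> X" if "agree (nat \<bar>i\<bar>) x x'" for x'
      proof
        assume "x' \<in> X"
        then have "x' i \<in> A" unfolding X avoiding_def by auto
        then show False using 1 that unfolding agree_def by simp
      qed
      then show ?thesis by blast
    next
      case 2
      have "x' \<notin> X" if "agree (nat \<bar>i\<bar> + length w) x x'" for x'
      proof -
        have "x' (i + int j) = w ! j" if "j < length w" for j
        proof -
          have "\<bar>i + int j\<bar> \<le> int (nat \<bar>i\<bar> + length w)" using that by linarith
          then show ?thesis using 2(2) that \<open>agree _ x x'\<close> unfolding agree_def by metis
        qed
        then show ?thesis using 2(1) unfolding X avoiding_def occurs_def by auto
      qed
      then show ?thesis by blast
    qed
  qed auto
  moreover have "shift ` X = X"
  proof
    show "shift ` X \<subseteq> X" 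
    proof
      fix z assume "z \<in> shift ` X"
      then obtain x where "x \<in> X" "z = shift x" by blast
      moreover have "range (shift x) \<subseteq> range x" unfolding shift_def by auto
      ultimately show "z \<in> X" unfolding X avoiding_def by auto
    qed
    show "X \<subseteq> shift ` X"
    proof
      fix x assume x: "x \<in> X"
      have eq: "x = shift (\<lambda>i. x (i - 1))" by (simp add: shift_def)
      have "range (\<lambda>i. x (i - 1)) \<subseteq> range x" by auto
      moreover have "occurs w (\<lambda>i. x (i - 1)) \<longleftrightarrow> occurs w x" for w
        using occurs_shift[of w "\<lambda>i. x (i - 1)"] eq by simp
      ultimately have "(\<lambda>i. x (i - 1)) \<in> X" using x unfolding X avoiding_def by auto
      with eq show "x \<in> shift ` X" by (rule image_eqI)
    qed
  qed
  ultimately show ?thesis unfolding shift_space_def using A finite_subset by blast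
qed

lemma shift_of_finite_type_window:
  assumes "shift_of_finite_type X"
  obtains L where "window_determined L X"
proof -
  obtain A F where F: "finite F" and X: "X = avoiding A F"
    using assms unfolding shift_of_finite_type_def by blast
  have "length w \<le> Suc (Max (insert 0 (length ` F)))" if "w \<in> F" for w
    using F that by (simp add: le_SucI)
  then show thesis using that window_determined_avoiding X by blast
qed

lemma one_step_window:
  assumes "one_step X"
  shows "window_determined 1 X"
  using assms window_determined_avoiding unfolding one_step_def by fastforce

text \<open>
  Forbidding the pairs of symbols that never occur side by side recovers \<open>Z\<close>: a pair that is not
  forbidden occurs in a point of \<open>Z\<close>, which can be shifted to show it at any given position.
\<close>

lemma one_stepI:
  assumes fin: "finite (alphabet Z)" and inv: "shift ` Z = Z" and win: "window_determined 1 Z"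
  shows "one_step Z"
proof -
  define F where "F = {[s, t] |s t. s \<in> alphabet Z \<and> t \<in> alphabet Z \<and>
    \<not> (\<exists>z\<in>Z. \<exists>i. z i = s \<and> z (i + 1) = t)}"
  have "F \<subseteq> (\<lambda>(s, t). [s, t]) ` (alphabet Z \<times> alphabet Z)" unfolding F_def by auto
  then have "finite F" using fin finite_subset by blast
  moreover have "Z = avoiding (alphabet Z) F"
  proof
    show "Z \<subseteq> avoiding (alphabet Z) F"
    proof
      fix z assume z: "z \<in> Z"
      have "\<not> occurs w z" if wF: "w \<in> F" for w
      proof
        assume "occurs w z"
        then obtain i where i: "\<And>j. j < length w \<Longrightarrow> z (i + int j) = w ! j"
          unfolding occurs_def by blast
        obtain s t where w: "w = [s, t]" "\<not> (\<exists>z\<in>Z. \<exists>i. z i = s \<and> z (i + 1) = t)"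
          using wF unfolding F_def by blast
        show False using i[of 0] i[of 1] w z by auto
      qed
      then show "z \<in> avoiding (alphabet Z) F" using z unfolding avoiding_def alphabet_def by auto
    qed
    show "avoiding (alphabet Z) F \<subseteq> Z"
    proof
      fix z assume z: "z \<in> avoiding (alphabet Z) F"
      have "\<exists>z'\<in>Z. \<forall>j\<in>{0..int 1}. z (i + j) = z' (i + j)" for i
      proof -
        have "occurs [z i, z (i + 1)] z"
          unfolding occurs_def by (intro exI[of _ i]) (auto simp: less_Suc_eq)
        then have "[z i, z (i + 1)] \<notin> F" using z unfolding avoiding_def by blast
        moreover have "z i \<in> alphabet Z" "z (i + 1) \<in> alphabet Z" using z unfolding avoiding_def by auto
        ultimately obtain z' k where z': "z' \<in> Z" "z' k = z i" "z' (k + 1) = z (i + 1)"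
          unfolding F_def by blast
        have "z (i + j) = z' (i + j + (k - i))" if "j \<in> {0..int 1}" for j
        proof -
          have "j = 0 \<or> j = 1" using that by auto
          then show ?thesis using z'(2,3) by (auto simp: algebra_simps)
        qed
        then show ?thesis using translate_mem[OF inv z'(1), of "k - i"] by (intro bexI) auto
      qed
      then show "z \<in> Z" using win unfolding window_determined_def by blast
    qed
  qed
  moreover have "\<forall>w\<in>F. length w = 2" unfolding F_def by auto
  ultimately show ?thesis using fin unfolding one_step_def by blast
qed

text \<open>
  An overlap of \<open>L\<close> symbols suffices: a window of \<open>L + 1\<close> symbols that starts before \<open>n\<close> has
  ended by the end of the overlap.
\<close>

lemma splice_mem:
  assumes win: "window_determined L X" and "v \<in> X" "u \<in> X"
    and eq: "\<And>j. n \<le> j \<Longrightarrow> j < n + int L \<Longrightarrow> v j = u j"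
  shows "(\<lambda>j. if j < n then v j else u j) \<in> X"
proof -
  have "\<exists>x'\<in>X. \<forall>j\<in>{0..int L}. (if i + j < n then v (i + j) else u (i + j)) = x' (i + j)" for i
  proof (cases "i < n")
    case True
    then show ?thesis using assms by (intro bexI[of _ v]) auto
  next
    case False
    then show ?thesis using assms by (intro bexI[of _ u]) auto
  qed
  then show ?thesis using win unfolding window_determined_def by simp
qed

section \<open>Transition classes\<close>

lemma transition_refl: "x \<in> X \<Longrightarrow> transition X \<pi> x x"
  unfolding transition_def by blast

text \<open>
  The first witness arrives at \<open>x'\<close> by time \<open>i\<close>; the second is made to follow \<open>x'\<close> long enough
  after \<open>i\<close> for the two to be spliced. The splice stays over the same point of \<open>Y\<close> because \<open>\<pi>\<close>
  acts symbol by symbol.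
\<close>

lemma transition_trans:
  assumes win: "window_determined L X" and pb: "symbol_map X \<pi> pb"
    and "transition X \<pi> x x'" "transition X \<pi> x' x''"
  shows "transition X \<pi> x x''"
  unfolding transition_def
proof
  fix n
  obtain v i where v: "v \<in> X" "\<pi> v = \<pi> x" "\<pi> x = \<pi> x'" "\<forall>j\<le>n. v j = x j"
    and i: "i \<ge> n" "\<forall>j\<ge>i. v j = x' j"
    using assms(3) unfolding transition_def by metis
  obtain u k where u: "u \<in> X" "\<pi> u = \<pi> x'" "\<pi> x' = \<pi> x''" "\<forall>j\<le>i + 1 + int L. u j = x' j"
    and k: "k \<ge> i + 1 + int L" "\<forall>j\<ge>k. u j = x'' j"
    using assms(4) unfolding transition_def by metis
  define z where "z = (\<lambda>j. if j < i + 1 then v j else u j)"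
  have z: "z \<in> X" unfolding z_def
    by (rule splice_mem[OF win v(1) u(1)]) (use i u in auto)
  have "\<pi> z j = \<pi> x j" for j
  proof -
    have "pb (v j) = \<pi> x j" "pb (u j) = \<pi> x j"
      using pb v u unfolding symbol_map_def by metis+
    then show ?thesis using pb z unfolding symbol_map_def z_def by simp
  qed
  then have "\<pi> z = \<pi> x" by blast
  moreover have "\<forall>j\<le>n. z j = x j" using v i unfolding z_def by auto
  moreover have "k \<ge> n" "\<forall>j\<ge>k. z j = x'' j" using k i unfolding z_def by auto
  ultimately show "\<exists>v\<in>X. \<pi> v = \<pi> x \<and> \<pi> x = \<pi> x'' \<and> (\<forall>j\<le>n. v j = x j) \<and>
      (\<exists>i\<ge>n. \<forall>j\<ge>i. v j = x'' j)"
    using z v u by metis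
qed

lemma equiv_transition_rel:
  assumes "window_determined L X" "symbol_map X \<pi> pb"
  shows "equiv X (transition_rel X \<pi>)"
proof (rule equivI)
  show "transition_rel X \<pi> \<subseteq> X \<times> X" unfolding transition_rel_def by auto
  show "refl_on X (transition_rel X \<pi>)"
    unfolding refl_on_def transition_rel_def using transition_refl by auto
  show "sym (transition_rel X \<pi>)" unfolding sym_def transition_rel_def by auto
  show "trans (transition_rel X \<pi>)"
    unfolding trans_def transition_rel_def using transition_trans[OF assms] by blast
qed

lemma transition_fiber: "transition X \<pi> x x' \<Longrightarrow> \<pi> x = \<pi> x'"
  unfolding transition_def by blast

lemma transition_classes_eq:
  assumes "window_determined L X" "symbol_map X \<pi> pb"
  shows "transition_classes X \<pi> y = (\<lambda>x. transition_rel X \<pi> `` {x}) ` {x\<in>X. \<pi> x = y}"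
proof -
  have "x \<in> transition_rel X \<pi> `` {x}" if "x \<in> X" for x
    using equiv_transition_rel[OF assms] that by (metis equiv_class_self)
  moreover have "transition_rel X \<pi> `` {x} \<subseteq> {x\<in>X. \<pi> x = y}" if "\<pi> x = y" for x
    using that transition_fiber[of X \<pi> x] unfolding transition_rel_def by auto
  ultimately show ?thesis
    unfolding transition_classes_def quotient_def by blast
qed

text \<open>
  A sliding block code carries witnesses of transitions to witnesses: outside a bounded
  neighbourhood of the switch, the image of the witness sees only one of the two points.
\<close>

lemma transition_image:
  assumes X: "compact_space (shift_top X)" "shift ` X = X"
    and f: "continuous_map (shift_top X) (shift_top X') f" "\<And>x. x \<in> X \<Longrightarrow> f (shift x) = shift (f x)"
    and fiber: "\<And>x x'. x \<in> X \<Longrightarrow> x' \<in> X \<Longrightarrow> \<pi> x = \<pi> x' \<Longrightarrow> \<pi>' (f x) = \<pi>' (f x')"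
    and x: "x \<in> X" "x' \<in> X" and trans: "transition X \<pi> x x'"
  shows "transition X' \<pi>' (f x) (f x')"
  unfolding transition_def
proof
  fix n
  obtain m where m: "\<And>x x' i. x \<in> X \<Longrightarrow> x' \<in> X \<Longrightarrow>
      (\<And>j. \<bar>j\<bar> \<le> int m \<Longrightarrow> x (i + j) = x' (i + j)) \<Longrightarrow> f x i = f x' i"
    using sliding_block_code[OF X f] by blast
  obtain v i where v: "v \<in> X" "\<pi> v = \<pi> x" "\<pi> x = \<pi> x'" "\<forall>j\<le>n + int m. v j = x j"
    and i: "i \<ge> n + int m" "\<forall>j\<ge>i. v j = x' j"
    using trans unfolding transition_def by metis
  have "f v \<in> X'" using f(1) v(1) unfolding continuous_shift_top by auto
  moreover have "\<forall>j\<le>n. f v j = f x j"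
  proof (intro allI impI)
    fix j assume "j \<le> n"
    show "f v j = f x j" by (rule m[OF v(1) x(1)]) (use v(4) \<open>j \<le> n\<close> in auto)
  qed
  moreover have "\<forall>j\<ge>i + int m. f v j = f x' j"
  proof (intro allI impI)
    fix j assume "i + int m \<le> j"
    show "f v j = f x' j" by (rule m[OF v(1) x(2)]) (use i(2) \<open>i + int m \<le> j\<close> in auto)
  qed
  moreover have "i + int m \<ge> n" using i by simp
  moreover have "\<pi>' (f v) = \<pi>' (f x)" "\<pi>' (f x) = \<pi>' (f x')" using fiber[OF v(1) x(1)] fiber[OF x] v by simp_all
  ultimately show "\<exists>v\<in>X'. \<pi>' v = \<pi>' (f x) \<and> \<pi>' (f x) = \<pi>' (f x') \<and> (\<forall>j\<le>n. v j = f x j) \<and>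
      (\<exists>i\<ge>n. \<forall>j\<ge>i. v j = f x' j)"
    by blast
qed

text \<open>In a 1-step shift a single common symbol is enough to switch from one point to the other.\<close>

lemma one_step_transition:
  assumes "one_step X" and pb: "symbol_map X \<pi> pb" and x: "x \<in> X" "x' \<in> X" "\<pi> x = \<pi> x'"
    and meet: "\<And>n. \<exists>k\<ge>n. x k = x' k"
  shows "transition X \<pi> x x'"
  unfolding transition_def
proof
  fix n
  obtain k where k: "k \<ge> n" "x k = x' k" using meet by blast
  define z where "z = (\<lambda>j. if j < k then x j else x' j)"
  have z: "z \<in> X" unfolding z_def
  proof (rule splice_mem[OF one_step_window[OF assms(1)] x(1,2)])
    fix j assume "k \<le> j" "j < k + int 1"
    then have "j = k" by simp
    then show "x j = x' j" using k by simp
  qed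
  have "\<pi> z j = \<pi> x j" for j
  proof -
    have "pb (x' j) = \<pi> x' j" "pb (x j) = \<pi> x j" "\<pi> z j = pb (z j)"
      using pb x(1,2) z unfolding symbol_map_def by simp_all
    then show ?thesis using x(3) unfolding z_def by simp
  qed
  then have "\<pi> z = \<pi> x" by blast
  moreover have "z j = x j" if "j \<le> n" for j
  proof (cases "j = k")
    case False
    then show ?thesis using k(1) that unfolding z_def by simp
  qed (use k(2) in \<open>simp add: z_def\<close>)
  moreover have "\<forall>j\<ge>k. z j = x' j" unfolding z_def by simp
  ultimately show "\<exists>v\<in>X. \<pi> v = \<pi> x \<and> \<pi> x = \<pi> x' \<and> (\<forall>j\<le>n. v j = x j) \<and>
      (\<exists>i\<ge>n. \<forall>j\<ge>i. v j = x' j)"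
    using z k(1) x(3) by blast
qed

section \<open>The upper bound\<close>

text \<open>
  The indicator of the points whose image shows \<open>w\<close> at \<open>0\<close> is continuous. Its averages along the
  forward orbit of \<open>y\<close> tend to the measure of \<open>w\<close>, and they would tend to \<open>0\<close> if \<open>w\<close> stopped
  occurring.
\<close>

lemma generic_recurrent:
  assumes sets: "sets \<nu> = sets (shift_borel Y)" and inv: "shift ` Y = Y"
    and gen: "generic_point Y \<nu> y"
    and cont: "continuous_map (shift_top Y) (shift_top Y') \<psi>"
    and comm: "\<And>z. z \<in> Y \<Longrightarrow> \<psi> (shift z) = shift (\<psi> z)"
    and pos: "measure (distr \<nu> (shift_borel Y') \<psi>) (cylinder Y' w) > 0"
  shows "\<exists>\<^sub>F k in sequentially. \<psi> y (int k) = w"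
proof (rule ccontr)
  assume "\<not> (\<exists>\<^sub>F k in sequentially. \<psi> y (int k) = w)"
  then have "\<forall>\<^sub>F k in sequentially. \<psi> y (int k) \<noteq> w" by (simp add: not_frequently)
  then obtain n where n: "\<And>k. k \<ge> n \<Longrightarrow> \<psi> y (int k) \<noteq> w"
    unfolding eventually_sequentially by blast
  have space: "space \<nu> = Y" using sets sets_eq_imp_space_eq space_shift_borel by blast
  have y: "y \<in> Y" using gen unfolding generic_point_def by blast
  define A where "A = {z\<in>Y. \<psi> z 0 = w}"
  have "\<psi> -` cylinder Y' w \<inter> space \<nu> = A"
    using cont unfolding continuous_shift_top cylinder_def A_def space by auto
  moreover have meas: "\<psi> \<in> measurable \<nu> (shift_borel Y')"
    using cont sets by (rule continuous_measurable)
  moreover have cyl: "cylinder Y' w \<in> sets (shift_borel Y')"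
    by (intro openin_sets_shift_borel openin_cylinder)
  ultimately have posA: "measure \<nu> A > 0" and A: "A \<in> sets \<nu>"
    using pos measure_distr[OF meas cyl] measurable_sets[OF meas cyl] by simp_all
  define f :: "(int \<Rightarrow> 'a) \<Rightarrow> real" where "f z = of_bool (\<psi> z 0 = w)" for z
  have "continuous_map (shift_top Y) euclideanreal f"
    unfolding continuous_map_def
  proof (intro conjI allI impI)
    fix U
    have "\<exists>m. \<forall>z'\<in>Y. agree m z z' \<longrightarrow> z' \<in> {z\<in>Y. f z \<in> U}" if "z \<in> {z\<in>Y. f z \<in> U}" for z
    proof -
      have "z \<in> Y" using that by blast
      with cont have "\<exists>m. \<forall>z'\<in>Y. agree m z z' \<longrightarrow> \<psi> z 0 = \<psi> z' 0"
        unfolding continuous_shift_top by blast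
      then obtain m where "\<forall>z'\<in>Y. agree m z z' \<longrightarrow> \<psi> z 0 = \<psi> z' 0" ..
      then have "f z' \<in> U" if "z' \<in> Y" "agree m z z'" for z'
        using that \<open>z \<in> {z\<in>Y. f z \<in> U}\<close> unfolding f_def by auto
      then show ?thesis by blast
    qed
    then show "openin (shift_top Y) {z \<in> topspace (shift_top Y). f z \<in> U}"
      unfolding openin_shift_top topspace_shift_top by blast
  qed auto
  then have "(\<lambda>N. (\<Sum>k<N. f ((shift ^^ k) y)) / real N) \<longlonglongrightarrow> integral\<^sup>L \<nu> f"
    using gen unfolding generic_point_def by blast
  moreover have "integral\<^sup>L \<nu> f = measure \<nu> A"
  proof -
    have "integral\<^sup>L \<nu> f = integral\<^sup>L \<nu> (indicator A)"
      by (rule Bochner_Integration.integral_cong) (auto simp: f_def A_def space)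
    also have "\<dots> = measure \<nu> A"
      using A sets.sets_into_space[OF A] by (simp add: Int_absorb2)
    finally show ?thesis .
  qed
  moreover have "(\<lambda>N. (\<Sum>k<N. f ((shift ^^ k) y)) / real N) \<longlonglongrightarrow> 0"
  proof (rule tendsto_sandwich[where f = "\<lambda>_. 0" and h = "\<lambda>N. real n / real N"])
    have f: "f ((shift ^^ k) y) = of_bool (\<psi> y (int k) = w)" for k
      unfolding f_def shift_funpow using translate_commute[of Y \<psi>, OF inv comm y] by simp
    have "(\<Sum>k<N. f ((shift ^^ k) y)) \<le> real n" for N
    proof -
      have "(\<Sum>k<N. f ((shift ^^ k) y)) \<le> (\<Sum>k<N. of_bool (k < n))"
        unfolding f using n by (intro sum_mono) (auto simp: not_le[symmetric])
      also have "\<dots> = real (card ({..<N} \<inter> {k. k < n}))"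
        by (simp add: of_bool_def sum.If_cases)
      also have "\<dots> \<le> real (card {..<n})"
        by (intro of_nat_mono card_mono) auto
      finally show ?thesis by simp
    qed
    then show "\<forall>\<^sub>F N in sequentially. (\<Sum>k<N. f ((shift ^^ k) y)) / real N \<le> real n / real N"
      by (intro always_eventually allI divide_right_mono) auto
    show "\<forall>\<^sub>F N in sequentially. 0 \<le> (\<Sum>k<N. f ((shift ^^ k) y)) / real N"
      unfolding f by (intro always_eventually allI divide_nonneg_nonneg sum_nonneg) auto
    show "(\<lambda>N. real n / real N) \<longlonglongrightarrow> 0" by (rule lim_const_over_n)
  qed simp
  ultimately show False using posA LIMSEQ_unique by fastforce
qed

lemma N_measure_le:
  assumes "finite (alphabet Y)" "w \<in> alphabet Y" "measure \<nu> (cylinder Y w) > 0"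
  shows "N_measure X Y \<nu> pb \<le> card {a\<in>alphabet X. pb a = w}"
proof -
  have "{card {a \<in> alphabet X. pb a = w} |w. w \<in> alphabet Y \<and> measure \<nu> (cylinder Y w) > 0}
      \<subseteq> (\<lambda>w. card {a \<in> alphabet X. pb a = w}) ` alphabet Y" by auto
  then have "finite {card {a \<in> alphabet X. pb a = w} |w.
      w \<in> alphabet Y \<and> measure \<nu> (cylinder Y w) > 0}"
    using assms(1) finite_subset by blast
  then show ?thesis unfolding N_measure_def using assms by (intro Min_le) auto
qed

text \<open>
  The minimum defining \<open>N_measure\<close> is over a nonempty set: the cylinders of the symbols cover the
  space, so they are not all null.
\<close>

lemma N_measure_attained:
  assumes fin: "finite (alphabet Y)" and "prob_space \<nu>" and sets: "sets \<nu> = sets (shift_borel Y)"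
  obtains w where "measure \<nu> (cylinder Y w) > 0"
    "N_measure X Y \<nu> pb = card {a\<in>alphabet X. pb a = w}"
proof -
  interpret prob_space \<nu> by fact
  let ?W = "{w \<in> alphabet Y. measure \<nu> (cylinder Y w) > 0}"
  have "space \<nu> = Y" using sets sets_eq_imp_space_eq space_shift_borel by blast
  then have "1 = measure \<nu> (\<Union>w\<in>alphabet Y. cylinder Y w)"
    using prob_space by (intro trans[OF prob_space[symmetric]] arg_cong[of _ _ "measure \<nu>"])
      (auto simp: cylinder_def alphabet_def)
  also have "\<dots> \<le> (\<Sum>w\<in>alphabet Y. measure \<nu> (cylinder Y w))"
    using fin sets openin_sets_shift_borel[OF openin_cylinder] by (intro measure_UNION_le) auto
  finally have "(\<Sum>w\<in>alphabet Y. measure \<nu> (cylinder Y w)) \<noteq> 0" by auto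
  then obtain w where "w \<in> alphabet Y" "measure \<nu> (cylinder Y w) \<noteq> 0"
    by (meson sum.neutral)
  then have "?W \<noteq> {}" using zero_less_measure_iff by blast
  moreover have eq: "{card {a \<in> alphabet X. pb a = w} |w.
      w \<in> alphabet Y \<and> measure \<nu> (cylinder Y w) > 0} = (\<lambda>w. card {a \<in> alphabet X. pb a = w}) ` ?W"
    by auto
  ultimately have "N_measure X Y \<nu> pb \<in> (\<lambda>w. card {a \<in> alphabet X. pb a = w}) ` ?W"
    unfolding N_measure_def eq using fin by (intro Min_in) auto
  then show thesis using that by blast
qed

lemma conjugacy_inverse:
  assumes "conjugacy X X' \<phi>" and inv: "shift ` X = X" "shift ` X' = X'"
  obtains g where "continuous_map (shift_top X') (shift_top X) g"
    "\<And>z. z \<in> X' \<Longrightarrow> g (shift z) = shift (g z)"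
    "\<And>x. x \<in> X \<Longrightarrow> g (\<phi> x) = x" "\<And>z. z \<in> X' \<Longrightarrow> \<phi> (g z) = z"
proof -
  obtain g where g: "homeomorphic_maps (shift_top X) (shift_top X') \<phi> g"
    using assms(1) unfolding conjugacy_def homeomorphic_map_maps by blast
  then have cont: "continuous_map (shift_top X') (shift_top X) g"
    and g\<phi>: "\<And>x. x \<in> X \<Longrightarrow> g (\<phi> x) = x" and \<phi>g: "\<And>z. z \<in> X' \<Longrightarrow> \<phi> (g z) = z"
    unfolding homeomorphic_maps_def by auto
  have "g (shift z) = shift (g z)" if z: "z \<in> X'" for z
  proof -
    have gz: "g z \<in> X" using cont z unfolding continuous_shift_top by auto
    then have "\<phi> (shift (g z)) = shift z"
      using assms(1) \<phi>g[OF z] unfolding conjugacy_def by simp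
    moreover have "shift (g z) \<in> X" using inv(1) gz by blast
    ultimately show ?thesis using g\<phi> by metis
  qed
  then show thesis using that cont g\<phi> \<phi>g by blast
qed

text \<open>
  Representatives of distinct classes, moved to a 1-step presentation, can share a symbol only
  finitely often, since every common symbol allows a switch. From some time on they therefore show
  distinct symbols, and at a later occurrence of \<open>w\<close> all of these lie over \<open>w\<close>.
\<close>

lemma card_transition_classes_le:
  assumes conj: "conjugate_triples_via X Y \<pi> X' Y' \<pi>' \<phi> \<psi>" and one: "one_step X'"
    and pb': "symbol_map X' \<pi>' pb'" and pb: "symbol_map X \<pi> pb"
    and rec: "\<exists>\<^sub>F k in sequentially. \<psi> y (int k) = w"
  shows "finite (transition_classes X \<pi> y) \<and>
    card (transition_classes X \<pi> y) \<le> card {a\<in>alphabet X'. pb' a = w}"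
proof (rule finite_if_finite_subsets_card_bdd)
  fix G assume GC: "G \<subseteq> transition_classes X \<pi> y" and fin: "finite G"
  have sft: "shift_of_finite_type X" "shift_of_finite_type X'"
    and \<phi>: "conjugacy X X' \<phi>" and \<psi>: "conjugacy Y Y' \<psi>"
    and \<pi>\<phi>: "\<And>x. x \<in> X \<Longrightarrow> \<pi>' (\<phi> x) = \<psi> (\<pi> x)" and \<pi>Y: "\<pi> ` X = Y"
    using conj unfolding conjugate_triples_via_def factor_triple_def factor_code_def by auto
  have sp: "shift_space X" "shift_space X'" using sft shift_of_finite_type_shift_space by auto
  then have inv: "shift ` X = X" "shift ` X' = X'" and comp': "compact_space (shift_top X')"
    and fin': "finite (alphabet X')"
    unfolding shift_space_def using compact_shift_top by auto
  obtain L where win: "window_determined L X" using shift_of_finite_type_window sft(1) by blast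
  obtain g where g: "continuous_map (shift_top X') (shift_top X) g"
    "\<And>z. z \<in> X' \<Longrightarrow> g (shift z) = shift (g z)"
    "\<And>x. x \<in> X \<Longrightarrow> g (\<phi> x) = x" "\<And>z. z \<in> X' \<Longrightarrow> \<phi> (g z) = z"
    using conjugacy_inverse[OF \<phi> inv] by blast
  have \<phi>X: "\<phi> x \<in> X'" if "x \<in> X" for x
    using \<phi> that unfolding conjugacy_def homeomorphic_eq_everything_map by auto
  have \<psi>inj: "inj_on \<psi> Y"
    using \<psi> unfolding conjugacy_def homeomorphic_eq_everything_map by auto
  have g_fiber: "\<pi> (g z) = \<pi> (g z')" if z: "z \<in> X'" "z' \<in> X'" "\<pi>' z = \<pi>' z'" for z z'
  proof -
    have gX: "g z \<in> X" "g z' \<in> X" using g(1) z unfolding continuous_shift_top by auto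
    then have "\<psi> (\<pi> (g z)) = \<psi> (\<pi> (g z'))" using \<pi>\<phi>[of "g z"] \<pi>\<phi>[of "g z'"] g(4) z by simp
    then show ?thesis using \<psi>inj gX \<pi>Y by (auto dest: inj_onD)
  qed
  have "\<forall>C\<in>G. \<exists>x. x \<in> X \<and> \<pi> x = y \<and> C = transition_rel X \<pi> `` {x}"
    using GC unfolding transition_classes_eq[OF win pb] by auto
  from bchoice[OF this] obtain r
    where r: "\<And>C. C \<in> G \<Longrightarrow> r C \<in> X" "\<And>C. C \<in> G \<Longrightarrow> \<pi> (r C) = y"
      "\<And>C. C \<in> G \<Longrightarrow> C = transition_rel X \<pi> `` {r C}" by blast
  have meet: "transition X \<pi> (r C) (r D)" if CD: "C \<in> G" "D \<in> G"
    and often: "\<exists>\<^sub>F k in sequentially. \<phi> (r C) (int k) = \<phi> (r D) (int k)" for C D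
  proof -
    have "transition X' \<pi>' (\<phi> (r C)) (\<phi> (r D))"
    proof (rule one_step_transition[OF one pb'])
      fix n
      obtain k where "k \<ge> nat n" "\<phi> (r C) (int k) = \<phi> (r D) (int k)"
        using often unfolding frequently_sequentially by blast
      then show "\<exists>k\<ge>n. \<phi> (r C) k = \<phi> (r D) k" by (intro exI[of _ "int k"]) auto
    qed (use \<phi>X \<pi>\<phi> r CD in simp_all)
    then have "transition X \<pi> (g (\<phi> (r C))) (g (\<phi> (r D)))"
    proof (rule transition_image[where \<pi>' = \<pi> and f = g, OF comp' inv(2) g(1), rotated -1])
      show "g (shift z) = shift (g z)" if "z \<in> X'" for z using that by (rule g(2))
      show "\<pi> (g z) = \<pi> (g z')" if "z \<in> X'" "z' \<in> X'" "\<pi>' z = \<pi>' z'" for z z'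
        using that by (rule g_fiber)
    qed (use \<phi>X r(1) CD in simp_all)
    then show ?thesis using g(3) r(1) CD by simp
  qed
  have "\<forall>\<^sub>F k in sequentially. \<forall>C\<in>G. \<forall>D\<in>G. C \<noteq> D \<longrightarrow> \<phi> (r C) (int k) \<noteq> \<phi> (r D) (int k)"
  proof (intro eventually_ball_finite fin ballI)
    fix C D assume CD: "C \<in> G" "D \<in> G"
    show "\<forall>\<^sub>F k in sequentially. C \<noteq> D \<longrightarrow> \<phi> (r C) (int k) \<noteq> \<phi> (r D) (int k)"
    proof (rule ccontr)
      assume *: "\<not> (\<forall>\<^sub>F k in sequentially. C \<noteq> D \<longrightarrow> \<phi> (r C) (int k) \<noteq> \<phi> (r D) (int k))"
      then have ne: "C \<noteq> D" by auto
      with * have often: "\<exists>\<^sub>F k in sequentially. \<phi> (r C) (int k) = \<phi> (r D) (int k)"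
        by (simp add: not_eventually)
      then have often': "\<exists>\<^sub>F k in sequentially. \<phi> (r D) (int k) = \<phi> (r C) (int k)"
        by (simp add: eq_commute)
      have "(r C, r D) \<in> transition_rel X \<pi>"
        unfolding transition_rel_def using meet[OF CD often] meet[OF CD(2,1) often'] r(1) CD by simp
      then have "C = D"
        using equiv_class_eq[OF equiv_transition_rel[OF win pb]] r(3)[OF CD(1)] r(3)[OF CD(2)] by metis
      then show False using ne by blast
    qed
  qed
  then obtain n where n: "\<And>k C D. k \<ge> n \<Longrightarrow> C \<in> G \<Longrightarrow> D \<in> G \<Longrightarrow> C \<noteq> D \<Longrightarrow>
      \<phi> (r C) (int k) \<noteq> \<phi> (r D) (int k)"
    unfolding eventually_sequentially by blast
  obtain k where k: "k \<ge> n" "\<psi> y (int k) = w" using rec unfolding frequently_sequentially by blast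
  show "card G \<le> card {a\<in>alphabet X'. pb' a = w}"
  proof (rule card_inj_on_le)
    show "inj_on (\<lambda>C. \<phi> (r C) (int k)) G" using n[OF k(1)] unfolding inj_on_def by blast
    show "(\<lambda>C. \<phi> (r C) (int k)) ` G \<subseteq> {a\<in>alphabet X'. pb' a = w}"
    proof (intro image_subsetI CollectI conjI)
      fix C assume C: "C \<in> G"
      show "\<phi> (r C) (int k) \<in> alphabet X'"
        unfolding alphabet_def using \<phi>X[OF r(1)[OF C]] by blast
      have "pb' (\<phi> (r C) (int k)) = \<pi>' (\<phi> (r C)) (int k)"
        using pb' \<phi>X[OF r(1)[OF C]] unfolding symbol_map_def by simp
      then show "pb' (\<phi> (r C) (int k)) = w" using \<pi>\<phi> r C k(2) by simp
    qed
    show "finite {a\<in>alphabet X'. pb' a = w}" using fin' by simp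
  qed
qed

section \<open>Higher block presentations\<close>

lemma block_code:
  assumes "finite (alphabet X)" "finite W"
  obtains c :: "(int \<Rightarrow> 'a) \<Rightarrow> int \<Rightarrow> nat" and n where
    "\<And>x x' i i'. x \<in> X \<Longrightarrow> x' \<in> X \<Longrightarrow> c x i = c x' i' \<longleftrightarrow> (\<forall>j\<in>W. x (i + j) = x' (i' + j))"
    "\<And>x i. x \<in> X \<Longrightarrow> c x i < n"
proof -
  define b where "b x i = (\<lambda>j\<in>W. x (i + j))" for x :: "int \<Rightarrow> 'a" and i
  let ?S = "Pi\<^sub>E W (\<lambda>_. alphabet X)"
  have "finite ?S" using assms by (simp add: finite_PiE)
  then obtain f :: "_ \<Rightarrow> nat" and n where f: "f ` ?S = {i. i < n}" "inj_on f ?S"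
    using finite_imp_inj_to_nat_seg by metis
  have b: "b x i \<in> ?S" if "x \<in> X" for x i
    unfolding b_def alphabet_def using that by auto
  show thesis
  proof (rule that[of "\<lambda>x i. f (b x i)" n])
    fix x x' i i' assume "x \<in> X" "x' \<in> X"
    then have "f (b x i) = f (b x' i') \<longleftrightarrow> b x i = b x' i'" using inj_on_eq_iff[OF f(2) b b] by simp
    also have "\<dots> \<longleftrightarrow> (\<forall>j\<in>W. x (i + j) = x' (i' + j))"
      unfolding b_def by (auto simp: restrict_def fun_eq_iff)
    finally show "f (b x i) = f (b x' i') \<longleftrightarrow> (\<forall>j\<in>W. x (i + j) = x' (i' + j))" .
  next
    fix x i assume "x \<in> X"
    then show "f (b x i) < n" using f(1) b by blast
  qed
qed

lemma injective_block_code: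
  assumes X: "shift_space X" and inj: "inj_on f X"
    and fin: "finite (alphabet (f ` X))"
    and comm: "\<And>x. x \<in> X \<Longrightarrow> f (shift x) = shift (f x)"
    and loc: "\<And>x x' i. x \<in> X \<Longrightarrow> x' \<in> X \<Longrightarrow>
      (\<And>j. \<bar>j\<bar> \<le> int m \<Longrightarrow> x (i + j) = x' (i + j)) \<Longrightarrow> f x i = f x' i"
  shows "conjugacy X (f ` X) f \<and> shift_space (f ` X)"
proof -
  have comp: "compact_space (shift_top X)"
    using X compact_shift_top unfolding shift_space_def by blast
  have cont: "continuous_map (shift_top X) (shift_top Z) f" if "f ` X \<subseteq> Z" for Z
    unfolding continuous_shift_top
  proof (intro conjI ballI allI that)
    fix x i assume x: "x \<in> X"
    have "f x i = f x' i" if "x' \<in> X" "agree (nat \<bar>i\<bar> + m) x x'" for x'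
      by (rule loc[OF x that(1)]) (use that(2) in \<open>auto simp: agree_def\<close>)
    then show "\<exists>m. \<forall>x'\<in>X. agree m x x' \<longrightarrow> f x i = f x' i" by blast
  qed
  have "homeomorphic_map (shift_top X) (shift_top (f ` X)) f"
    by (rule continuous_imp_homeomorphic_map)
      (use comp Hausdorff_shift_top cont inj in auto)
  then have "conjugacy X (f ` X) f" unfolding conjugacy_def using comm by blast
  have "compactin (shift_top UNIV) (f ` X)"
    using image_compactin[OF _ cont] comp unfolding compact_space_def by simp
  then have "closedin (shift_top UNIV) (f ` X)"
    using compactin_imp_closedin Hausdorff_shift_top by blast
  moreover have "shift ` f ` X = f ` X"
  proof -
    have "shift ` f ` X = f ` shift ` X" using comm by (auto simp: image_image)
    then show ?thesis using X unfolding shift_space_def by simp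
  qed
  ultimately have "shift_space (f ` X)" unfolding shift_space_def using fin by simp
  with \<open>conjugacy X (f ` X) f\<close> show ?thesis by blast
qed

lemma factor_code_compose:
  assumes "factor_code X Y \<rho>" "conjugacy Y Z \<psi>"
  shows "factor_code X Z (\<psi> \<circ> \<rho>)"
proof -
  have "\<psi> ` Y = Z" "continuous_map (shift_top Y) (shift_top Z) \<psi>"
    using assms(2) unfolding conjugacy_def homeomorphic_eq_everything_map by auto
  then show ?thesis
    using assms unfolding factor_code_def conjugacy_def
    by (auto intro: continuous_map_compose simp: image_comp[symmetric])
qed

text \<open>
  If each point of a sequence agrees with the next one on the window around the next position,
  then every window reads the diagonal sequence.
\<close>

lemma overlapping_windows:
  fixes g :: "int \<Rightarrow> int \<Rightarrow> 'a"
  assumes step: "\<And>i j. j \<in> {- int a..int b} \<Longrightarrow> g i (i + 1 + j) = g (i + 1) (i + 1 + j)"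
    and j: "j \<in> {- int a..int b}"
  shows "g i (i + j) = g (i + j) (i + j)"
proof -
  have pos: "k \<le> b \<Longrightarrow> g i (i + int k) = g (i + int k) (i + int k)" for k i
  proof (induction k arbitrary: i)
    case (Suc k)
    have "g i (i + 1 + int k) = g (i + 1) (i + 1 + int k)" using Suc.prems by (intro step) auto
    also have "\<dots> = g (i + 1 + int k) (i + 1 + int k)" using Suc by simp
    finally show ?case by (simp add: algebra_simps)
  qed simp
  have neg: "k \<le> a \<Longrightarrow> g i (i - int k) = g (i - int k) (i - int k)" for k i
  proof (induction k arbitrary: i)
    case (Suc k)
    have "g (i - 1) (i - 1 + 1 + (- int (Suc k))) = g (i - 1 + 1) (i - 1 + 1 + (- int (Suc k)))"
      using Suc.prems by (intro step) auto
    then have "g i (i - int (Suc k)) = g (i - 1) (i - 1 - int k)" by (simp add: algebra_simps)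
    also have "\<dots> = g (i - 1 - int k) (i - 1 - int k)" using Suc by simp
    finally show ?case by (simp add: algebra_simps)
  qed simp
  show ?thesis
  proof (cases "j \<ge> 0")
    case True
    then show ?thesis using pos[of "nat j" i] j by simp
  next
    case False
    then show ?thesis using neg[of "nat (- j)" i] j by simp
  qed
qed

text \<open>
  The symbol at position \<open>i\<close> records \<open>x\<close> on \<open>[i, i + L]\<close>. Consecutive symbols
  of a sequence force these windows to overlap consistently, so the sequence comes from a point all
  of whose windows are admissible, that is, from a point of \<open>X\<close>; hence the recoded domain is
  1-step. The symbol also records \<open>\<pi> x\<close> on \<open>[i - m, i + m]\<close>, so that the code stays 1-block when
  \<open>Y\<close> is recoded by its blocks of that shape; \<open>m\<close> can be taken as large as desired.
\<close>

lemma higher_block_presentation: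
  assumes ft: "factor_triple X Y \<pi>" and pb: "symbol_map X \<pi> pb" and win: "window_determined L X"
  obtains X' Y' :: "(int \<Rightarrow> nat) set" and \<pi>' pb' \<phi> \<psi> where
    "conjugate_triples_via X Y \<pi> X' Y' \<pi>' \<phi> \<psi>" "one_step X'" "symbol_map X' \<pi>' pb'"
    "\<And>x x' i. x \<in> X \<Longrightarrow> x' \<in> X \<Longrightarrow> \<phi> x i = \<phi> x' i \<longleftrightarrow>
      (\<forall>j\<in>{0..int L}. x (i + j) = x' (i + j)) \<and>
      (\<forall>j\<in>{- int m..int m}. \<pi> x (i + j) = \<pi> x' (i + j))"
    "\<And>y y' i. y \<in> Y \<Longrightarrow> y' \<in> Y \<Longrightarrow> \<psi> y i = \<psi> y' i \<longleftrightarrow>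
      (\<forall>j\<in>{- int m..int m}. y (i + j) = y' (i + j))"
proof -
  have sftX: "shift_of_finite_type X" and sofY: "sofic Y" and fc: "factor_code X Y \<pi>"
    using ft unfolding factor_triple_def by auto
  have spX: "shift_space X" using sftX by (rule shift_of_finite_type_shift_space)
  have spY: "shift_space Y" using sofY unfolding sofic_def by blast
  have finX: "finite (alphabet X)" and invX: "shift ` X = X" using spX unfolding shift_space_def by auto
  have finY: "finite (alphabet Y)" and invY: "shift ` Y = Y" using spY unfolding shift_space_def by auto
  have \<pi>Y: "\<And>x. x \<in> X \<Longrightarrow> \<pi> x \<in> Y" and \<pi>im: "\<pi> ` X = Y"
    and \<pi>shift: "\<And>x. x \<in> X \<Longrightarrow> \<pi> (shift x) = shift (\<pi> x)"
    using fc unfolding factor_code_def by auto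
  have shX: "\<And>x. x \<in> X \<Longrightarrow> shift x \<in> X" and shY: "\<And>x. x \<in> Y \<Longrightarrow> shift x \<in> Y"
    using invX invY by blast+
  have \<pi>b: "\<pi> x i = pb (x i)" if "x \<in> X" for x i using pb that unfolding symbol_map_def by simp
  obtain c n where c: "\<And>x x' i i'. x \<in> X \<Longrightarrow> x' \<in> X \<Longrightarrow>
      c x i = c x' i' \<longleftrightarrow> (\<forall>j\<in>{0..int L}. x (i + j) = x' (i' + j))"
    and cn: "\<And>x i. x \<in> X \<Longrightarrow> c x i < (n::nat)"
    using block_code[OF finX, of "{0..int L}"] by auto
  obtain \<psi> p where \<psi>: "\<And>y y' i i'. y \<in> Y \<Longrightarrow> y' \<in> Y \<Longrightarrow>
      \<psi> y i = \<psi> y' i' \<longleftrightarrow> (\<forall>j\<in>{- int m..int m}. y (i + j) = y' (i' + j))"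
    and \<psi>p: "\<And>y i. y \<in> Y \<Longrightarrow> \<psi> y i < (p::nat)"
    using block_code[OF finY, of "{- int m..int m}"] by auto
  define \<phi> where "\<phi> x i = prod_encode (c x i, \<psi> (\<pi> x) i)" for x i
  define pb' where "pb' s = snd (prod_decode s)" for s
  define \<pi>' :: "(int \<Rightarrow> nat) \<Rightarrow> int \<Rightarrow> nat" where "\<pi>' z i = pb' (z i)" for z i
  have \<phi>eq: "\<phi> x i = \<phi> x' i' \<longleftrightarrow> (\<forall>j\<in>{0..int L}. x (i + j) = x' (i' + j)) \<and>
      (\<forall>j\<in>{- int m..int m}. \<pi> x (i + j) = \<pi> x' (i' + j))" if "x \<in> X" "x' \<in> X" for x x' i i'
    unfolding \<phi>_def using c[OF that] \<psi>[OF \<pi>Y[OF that(1)] \<pi>Y[OF that(2)]] by simp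
  have \<phi>shift: "\<phi> (shift x) = shift (\<phi> x)" if "x \<in> X" for x
  proof
    fix i
    have "\<phi> (shift x) i = \<phi> x (i + 1)"
      unfolding \<phi>eq[OF shX[OF that] that] unfolding \<pi>shift[OF that]
      unfolding shift_def by (simp add: algebra_simps)
    then show "\<phi> (shift x) i = shift (\<phi> x) i" by (simp add: shift_def)
  qed
  have \<psi>shift: "\<psi> (shift y) = shift (\<psi> y)" if "y \<in> Y" for y
  proof
    fix i
    have "\<psi> (shift y) i = \<psi> y (i + 1)"
      unfolding \<psi>[OF shY[OF that] that] unfolding shift_def by (simp add: algebra_simps)
    then show "\<psi> (shift y) i = shift (\<psi> y) i" by (simp add: shift_def)
  qed
  have \<phi>inj: "inj_on \<phi> X"
  proof (intro inj_onI ext)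
    fix x x' i assume x: "x \<in> X" "x' \<in> X" and "\<phi> x = \<phi> x'"
    then have "\<phi> x i = \<phi> x' i" by simp
    then have "\<forall>j\<in>{0..int L}. x (i + j) = x' (i + j)" using \<phi>eq[OF x] by blast
    then have "x (i + 0) = x' (i + 0)" by (rule bspec) simp
    then show "x i = x' i" by simp
  qed
  have \<psi>inj: "inj_on \<psi> Y"
  proof (intro inj_onI ext)
    fix x x' i assume x: "x \<in> Y" "x' \<in> Y" and "\<psi> x = \<psi> x'"
    then have "\<psi> x i = \<psi> x' i" by simp
    then have "\<forall>j\<in>{- int m..int m}. x (i + j) = x' (i + j)" using \<psi>[OF x] by blast
    then have "x (i + 0) = x' (i + 0)" by (rule bspec) simp
    then show "x i = x' i" by simp
  qed
  have fin\<phi>: "finite (alphabet (\<phi> ` X))"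
  proof (rule finite_subset)
    show "alphabet (\<phi> ` X) \<subseteq> prod_encode ` ({..<n} \<times> {..<p})"
      unfolding alphabet_def \<phi>_def using cn \<psi>p \<pi>Y by auto
  qed simp
  have fin\<psi>: "finite (alphabet (\<psi> ` Y))"
  proof (rule finite_subset)
    show "alphabet (\<psi> ` Y) \<subseteq> {..<p}" unfolding alphabet_def using \<psi>p by auto
  qed simp
  have \<phi>loc: "\<phi> x i = \<phi> x' i" if x: "x \<in> X" "x' \<in> X"
    and eq: "\<And>j. \<bar>j\<bar> \<le> int (L + m) \<Longrightarrow> x (i + j) = x' (i + j)" for x x' i
    unfolding \<phi>eq[OF x] using eq by (auto simp: \<pi>b x)
  have \<psi>loc: "\<psi> y i = \<psi> y' i" if y: "y \<in> Y" "y' \<in> Y"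
    and eq: "\<And>j. \<bar>j\<bar> \<le> int m \<Longrightarrow> y (i + j) = y' (i + j)" for y y' i
    unfolding \<psi>[OF y] using eq by auto
  have "conjugacy X (\<phi> ` X) \<phi> \<and> shift_space (\<phi> ` X)"
    by (rule injective_block_code[where m = "L + m"]) (fact spX \<phi>inj fin\<phi> \<phi>shift \<phi>loc)+
  then have conj\<phi>: "conjugacy X (\<phi> ` X) \<phi>" and sp\<phi>: "shift_space (\<phi> ` X)" by auto
  have "conjugacy Y (\<psi> ` Y) \<psi> \<and> shift_space (\<psi> ` Y)"
    by (rule injective_block_code[where m = m]) (fact spY \<psi>inj fin\<psi> \<psi>shift \<psi>loc)+
  then have conj\<psi>: "conjugacy Y (\<psi> ` Y) \<psi>" and sp\<psi>: "shift_space (\<psi> ` Y)" by auto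
  have \<pi>'\<phi>: "\<pi>' (\<phi> x) = \<psi> (\<pi> x)" for x
    unfolding \<pi>'_def pb'_def \<phi>_def by simp
  have "window_determined 1 (\<phi> ` X)"
    unfolding window_determined_def
  proof (intro allI impI)
    fix z assume z: "\<forall>i. \<exists>z'\<in>\<phi> ` X. \<forall>j\<in>{0..int 1}. z (i + j) = z' (i + j)"
    have "\<forall>i. \<exists>x. x \<in> X \<and> z i = \<phi> x i \<and> z (i + 1) = \<phi> x (i + 1)"
    proof
      fix i
      obtain x where x: "x \<in> X" "\<forall>j\<in>{0..int 1}. z (i + j) = \<phi> x (i + j)"
        using z[THEN spec, of i] by auto
      have "z (i + 0) = \<phi> x (i + 0)" by (rule bspec[OF x(2)]) simp
      moreover have "z (i + 1) = \<phi> x (i + 1)" by (rule bspec[OF x(2)]) simp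
      ultimately show "\<exists>x. x \<in> X \<and> z i = \<phi> x i \<and> z (i + 1) = \<phi> x (i + 1)" using x(1) by auto
    qed
    from choice[OF this] obtain g where g: "\<And>i. g i \<in> X" "\<And>i. z i = \<phi> (g i) i"
      "\<And>i. z (i + 1) = \<phi> (g i) (i + 1)" by blast
    have "\<phi> (g i) (i + 1) = \<phi> (g (i + 1)) (i + 1)" for i using g(2)[of "i + 1"] g(3)[of i] by simp
    then have step: "\<And>i j. j \<in> {0..int L} \<Longrightarrow> g i (i + 1 + j) = g (i + 1) (i + 1 + j)"
      "\<And>i j. j \<in> {- int m..int m} \<Longrightarrow> \<pi> (g i) (i + 1 + j) = \<pi> (g (i + 1)) (i + 1 + j)"
      using \<phi>eq[OF g(1) g(1)] by blast+
    define x where "x i = g i i" for i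
    have gx: "g i (i + j) = x (i + j)" if "j \<in> {0..int L}" for i j
      unfolding x_def by (rule overlapping_windows[where g = g and a = 0 and b = L])
        (use step(1) that in simp_all)
    have "\<exists>x'\<in>X. \<forall>j\<in>{0..int L}. x (i + j) = x' (i + j)" for i
      using g(1)[of i] gx[of _ i] by (intro bexI[of _ "g i"]) simp_all
    then have x: "x \<in> X" using win unfolding window_determined_def by blast
    have \<pi>gx: "\<pi> (g i) (i + j) = \<pi> x (i + j)" if "j \<in> {- int m..int m}" for i j
    proof -
      have "\<pi> (g i) (i + j) = \<pi> (g (i + j)) (i + j)"
        by (rule overlapping_windows[where g = "\<lambda>i. \<pi> (g i)" and a = m and b = m])
          (use step(2) that in simp_all)
      then show ?thesis by (simp add: \<pi>b x g(1) x_def)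
    qed
    have "\<phi> x i = z i" for i
      unfolding g(2) \<phi>eq[OF x g(1)] using gx \<pi>gx by simp
    then have "z = \<phi> x" by auto
    then show "z \<in> \<phi> ` X" using x by blast
  qed
  then have one: "one_step (\<phi> ` X)"
    by (rule one_stepI[OF fin\<phi> conjunct2[OF conjunct2[OF sp\<phi>[unfolded shift_space_def]]]])
  have sft: "shift_of_finite_type (\<phi> ` X)"
    using one unfolding one_step_def shift_of_finite_type_def by blast
  have sof: "sofic (\<psi> ` Y)"
    using sofY sp\<psi> factor_code_compose[OF _ conj\<psi>] unfolding sofic_def by blast
  have fc': "factor_code (\<phi> ` X) (\<psi> ` Y) \<pi>'"
    unfolding factor_code_def
  proof (intro conjI ballI)
    show im: "\<pi>' ` \<phi> ` X = \<psi> ` Y" using \<pi>im by (auto simp: image_image \<pi>'\<phi>)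
    show "continuous_map (shift_top (\<phi> ` X)) (shift_top (\<psi> ` Y)) \<pi>'"
      unfolding continuous_shift_top
    proof (intro conjI ballI allI)
      fix z i
      have "\<pi>' z i = \<pi>' z' i" if "agree (nat \<bar>i\<bar>) z z'" for z'
        using that unfolding agree_def \<pi>'_def by simp
      then show "\<exists>m. \<forall>z'\<in>\<phi> ` X. agree m z z' \<longrightarrow> \<pi>' z i = \<pi>' z' i" by blast
    qed (use im in simp)
    show "\<pi>' (shift z) = shift (\<pi>' z)" for z unfolding \<pi>'_def shift_def by simp
  qed
  show thesis
  proof (rule that)
    show "conjugate_triples_via X Y \<pi> (\<phi> ` X) (\<psi> ` Y) \<pi>' \<phi> \<psi>"
      unfolding conjugate_triples_via_def factor_triple_def[of "\<phi> ` X"]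
      using ft sft sof fc' conj\<phi> conj\<psi> \<pi>'\<phi> by simp
    show "symbol_map (\<phi> ` X) \<pi>' pb'" unfolding symbol_map_def \<pi>'_def by simp
  qed (use one \<phi>eq \<psi> in auto)
qed

section \<open>Equality for finite-to-one codes\<close>

text \<open>
  The witnesses for a transition \<open>x \<rightarrow> x'\<close> lie in a finite fiber, so one that follows \<open>x\<close> up to
  a sufficiently late coordinate is \<open>x\<close> itself.
\<close>

lemma transition_right_asymptotic:
  assumes fin: "finite {v\<in>X. \<pi> v = \<pi> x}" and trans: "transition X \<pi> x x'"
  shows "\<forall>\<^sub>F n in at_top. \<forall>j\<ge>n. x j = x' j"
proof -
  have "\<forall>\<^sub>F n in at_top. \<forall>v\<in>{v\<in>X. \<pi> v = \<pi> x}. (\<forall>j\<le>n. v j = x j) \<longrightarrow> v = x"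
  proof (intro eventually_ball_finite fin ballI)
    fix v
    show "\<forall>\<^sub>F n in at_top. (\<forall>j\<le>n. v j = x j) \<longrightarrow> v = x"
    proof (cases "v = x")
      case False
      then obtain k where k: "v k \<noteq> x k" by blast
      have "\<forall>\<^sub>F n in at_top. \<not> (\<forall>j\<le>n. v j = x j)"
        using eventually_ge_at_top[of k] by (rule eventually_mono) (use k in blast)
      then show ?thesis by (rule eventually_mono) blast
    qed simp
  qed
  then obtain n where n: "\<And>v. v \<in> X \<Longrightarrow> \<pi> v = \<pi> x \<Longrightarrow> \<forall>j\<le>n. v j = x j \<Longrightarrow> v = x"
    unfolding eventually_at_top_linorder by blast
  obtain v i where "v \<in> X" "\<pi> v = \<pi> x" "\<forall>j\<le>n. v j = x j" "\<forall>j\<ge>i. v j = x' j"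
    using trans[unfolded transition_def, rule_format, of n] by blast
  then have "\<forall>j\<ge>i. x j = x' j" using n by blast
  then show ?thesis unfolding eventually_at_top_linorder by (meson order_trans)
qed

text \<open>
  By compactness, a sufficiently long block of \<open>y\<close> around \<open>i\<close> forces every point over it to look
  on \<open>[i, i + L]\<close> like a point of the fiber of \<open>y\<close>.
\<close>

lemma long_block_fiber:
  assumes comp: "compact_space (shift_top X)" and pb: "symbol_map X \<pi> pb"
  obtains m where "\<And>x. x \<in> X \<Longrightarrow> \<forall>j\<in>{- int m..int m}. \<pi> x (i + j) = y (i + j) \<Longrightarrow>
    \<exists>x'\<in>X. \<pi> x' = y \<and> (\<forall>j\<in>{0..int L}. x (i + j) = x' (i + j))"
proof -
  define P where "P m x \<longleftrightarrow> (\<exists>j\<in>{- int m..int m}. \<pi> x (i + j) \<noteq> y (i + j)) \<or>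
    (\<exists>x'\<in>X. \<pi> x' = y \<and> (\<forall>j\<in>{0..int L}. x (i + j) = x' (i + j)))" for m x
  have \<pi>b: "\<pi> x i = pb (x i)" if "x \<in> X" for x i using pb that unfolding symbol_map_def by simp
  have "\<exists>m. \<forall>x\<in>X. P m x"
  proof (rule compact_exhaustion[OF comp, of P])
    fix m x assume x: "x \<in> X" "P m x"
    have "P m x'" if x': "x' \<in> X" and eq: "agree (nat \<bar>i\<bar> + m + L) x x'" for x'
    proof -
      have *: "x' (i + j) = x (i + j)" if "\<bar>j\<bar> \<le> int (m + L)" for j
      proof -
        have "\<bar>i + j\<bar> \<le> int (nat \<bar>i\<bar> + m + L)" using that by simp
        then show ?thesis using eq unfolding agree_def by simp
      qed
      have "\<pi> x' (i + j) = \<pi> x (i + j)" if "j \<in> {- int m..int m}" for j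
      proof -
        have "\<bar>j\<bar> \<le> int (m + L)" using that by auto
        then show ?thesis using * \<pi>b[OF x'] \<pi>b[OF x(1)] by simp
      qed
      moreover have "x' (i + j) = x (i + j)" if "j \<in> {0..int L}" for j
        using * that by simp
      ultimately show ?thesis using x(2) unfolding P_def by simp
    qed
    then show "\<exists>k. \<forall>x'\<in>X. agree k x x' \<longrightarrow> P m x'" by blast
  next
    fix m n x assume "P m x" "m \<le> n"
    moreover have "{- int m..int m} \<subseteq> {- int n..int n}" using \<open>m \<le> n\<close> by auto
    ultimately show "P n x" unfolding P_def by blast
  next
    fix x assume x: "x \<in> X"
    show "\<exists>m. P m x"
    proof (cases "\<pi> x = y")
      case True
      then show ?thesis unfolding P_def using x by blast
    next
      case False
      then obtain k where "\<pi> x k \<noteq> y k" by blast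
      then have "\<pi> x (i + (k - i)) \<noteq> y (i + (k - i))" by simp
      moreover have "k - i \<in> {- int (nat \<bar>k - i\<bar>)..int (nat \<bar>k - i\<bar>)}" by auto
      ultimately have "P (nat \<bar>k - i\<bar>) x" unfolding P_def by blast
      then show ?thesis by blast
    qed
  qed
  then show thesis using that unfolding P_def by blast
qed

text \<open>
  Beyond some position \<open>i\<close> the points of the fiber of \<open>y\<close> show one future per transition class, and
  a long enough block of \<open>y\<close> around \<open>i\<close> leaves room for no other symbols.
\<close>

lemma presentation_with_class_many_symbols:
  assumes ft: "factor_triple X Y \<pi>" and pb: "symbol_map X \<pi> pb"
    and fto: "finite_to_one X Y \<pi>" and y: "y \<in> Y"
  obtains X' Y' :: "(int \<Rightarrow> nat) set" and \<pi>' pb' \<phi> \<psi> i where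
    "conjugate_triples_via X Y \<pi> X' Y' \<pi>' \<phi> \<psi>" "one_step X'" "symbol_map X' \<pi>' pb'"
    "card {a\<in>alphabet X'. pb' a = \<psi> y i} \<le> card (transition_classes X \<pi> y)"
proof -
  have sft: "shift_of_finite_type X" and fc: "factor_code X Y \<pi>"
    using ft unfolding factor_triple_def by auto
  have sp: "shift_space X" using sft by (rule shift_of_finite_type_shift_space)
  then have inv: "shift ` X = X" and comp: "compact_space (shift_top X)"
    unfolding shift_space_def using compact_shift_top by auto
  have \<pi>Y: "\<And>x. x \<in> X \<Longrightarrow> \<pi> x \<in> Y" using fc unfolding factor_code_def by auto
  obtain L where win: "window_determined L X" using shift_of_finite_type_window[OF sft] .
  define F where "F = {x\<in>X. \<pi> x = y}"
  have F: "finite F" using fto y unfolding F_def finite_to_one_def by blast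
  let ?R = "transition_rel X \<pi>"
  have "\<forall>\<^sub>F i in at_top. \<forall>x\<in>F. \<forall>x'\<in>F. (x, x') \<in> ?R \<longrightarrow> (\<forall>j\<ge>i. x j = x' j)"
  proof (intro eventually_ball_finite F ballI)
    fix x x' assume xF: "x \<in> F" "x' \<in> F"
    have "\<forall>\<^sub>F i in at_top. \<forall>j\<ge>i. x j = x' j" if "(x, x') \<in> ?R"
    proof (rule transition_right_asymptotic)
      show "finite {v \<in> X. \<pi> v = \<pi> x}" using F xF unfolding F_def by simp
      show "transition X \<pi> x x'" using that unfolding transition_rel_def by blast
    qed
    then show "\<forall>\<^sub>F i in at_top. (x, x') \<in> ?R \<longrightarrow> (\<forall>j\<ge>i. x j = x' j)"
      by (cases "(x, x') \<in> ?R") simp_all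
  qed
  then obtain i where i: "\<And>x x' j. x \<in> F \<Longrightarrow> x' \<in> F \<Longrightarrow> (x, x') \<in> ?R \<Longrightarrow> j \<ge> i \<Longrightarrow> x j = x' j"
    unfolding eventually_at_top_linorder by blast
  obtain m where m: "\<And>x. x \<in> X \<Longrightarrow> \<forall>j\<in>{- int m..int m}. \<pi> x (i + j) = y (i + j) \<Longrightarrow>
      \<exists>x'\<in>X. \<pi> x' = y \<and> (\<forall>j\<in>{0..int L}. x (i + j) = x' (i + j))"
    using long_block_fiber[OF comp pb, where i = i and y = y and L = L] by blast
  obtain X' Y' :: "(int \<Rightarrow> nat) set" and \<pi>' pb' \<phi> \<psi> where
    conj: "conjugate_triples_via X Y \<pi> X' Y' \<pi>' \<phi> \<psi>" and one: "one_step X'"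
    and pb': "symbol_map X' \<pi>' pb'"
    and \<phi>: "\<And>x x' i. x \<in> X \<Longrightarrow> x' \<in> X \<Longrightarrow> \<phi> x i = \<phi> x' i \<longleftrightarrow>
      (\<forall>j\<in>{0..int L}. x (i + j) = x' (i + j)) \<and>
      (\<forall>j\<in>{- int m..int m}. \<pi> x (i + j) = \<pi> x' (i + j))"
    and \<psi>: "\<And>y y' i. y \<in> Y \<Longrightarrow> y' \<in> Y \<Longrightarrow> \<psi> y i = \<psi> y' i \<longleftrightarrow>
      (\<forall>j\<in>{- int m..int m}. y (i + j) = y' (i + j))"
    by (rule higher_block_presentation[OF ft pb win, where m = m]) blast
  have \<phi>X: "\<phi> ` X = X'" and \<phi>shift: "\<And>x. x \<in> X \<Longrightarrow> \<phi> (shift x) = shift (\<phi> x)"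
    and \<pi>\<phi>: "\<And>x. x \<in> X \<Longrightarrow> \<pi>' (\<phi> x) = \<psi> (\<pi> x)"
    using conj unfolding conjugate_triples_via_def conjugacy_def homeomorphic_eq_everything_map
    by auto
  have "{a\<in>alphabet X'. pb' a = \<psi> y i} \<subseteq> (\<lambda>x. \<phi> x i) ` F"
  proof
    fix a assume "a \<in> {a\<in>alphabet X'. pb' a = \<psi> y i}"
    then obtain x0 k where x0: "x0 \<in> X" "a = \<phi> x0 k" and a: "pb' a = \<psi> y i"
      unfolding alphabet_def \<phi>X[symmetric] by auto
    \<comment> \<open>The symbol may occur at any position \<open>k\<close>; translating brings it to position \<open>i\<close>.\<close>
    define x where "x = (\<lambda>j. x0 (j + (k - i)))"
    have x: "x \<in> X" unfolding x_def by (rule translate_mem[OF inv x0(1)])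
    have "\<phi> x = (\<lambda>j. \<phi> x0 (j + (k - i)))"
      unfolding x_def by (rule translate_commute[of X, OF inv _ x0(1)]) (rule \<phi>shift)
    then have ax: "a = \<phi> x i" using x0(2) by simp
    have "\<psi> (\<pi> x) i = \<psi> y i"
    proof -
      have "\<pi>' (\<phi> x) i = pb' (\<phi> x i)" using pb' x \<phi>X unfolding symbol_map_def by blast
      then show ?thesis using \<pi>\<phi>[OF x] a ax by simp
    qed
    then have eq: "\<forall>j\<in>{- int m..int m}. \<pi> x (i + j) = y (i + j)" using \<psi>[OF \<pi>Y[OF x] y] by blast
    then obtain x' where x': "x' \<in> X" "\<pi> x' = y" "\<forall>j\<in>{0..int L}. x (i + j) = x' (i + j)"
      using m[OF x] by blast
    then have "\<phi> x i = \<phi> x' i" using \<phi>[OF x x'(1)] eq by simp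
    then show "a \<in> (\<lambda>x. \<phi> x i) ` F" using ax x' unfolding F_def by blast
  qed
  moreover have classes: "transition_classes X \<pi> y = (\<lambda>x. ?R `` {x}) ` F"
    unfolding F_def by (rule transition_classes_eq[OF win pb])
  have "(\<lambda>x. \<phi> x i) ` F \<subseteq> (\<lambda>C. \<phi> (SOME x. x \<in> C) i) ` transition_classes X \<pi> y"
  proof
    fix a assume "a \<in> (\<lambda>x. \<phi> x i) ` F"
    then obtain x where x: "x \<in> F" "a = \<phi> x i" by blast
    then have xX: "x \<in> X" unfolding F_def by blast
    define x' where "x' = (SOME x'. x' \<in> ?R `` {x})"
    have "x \<in> ?R `` {x}" using equiv_class_self[OF equiv_transition_rel[OF win pb] xX] .
    then have x': "(x, x') \<in> ?R" unfolding x'_def by (metis Image_singleton_iff someI)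
    then have "x' \<in> X" "\<pi> x = \<pi> x'"
      unfolding transition_rel_def using transition_fiber[of X \<pi> x x'] by auto
    then have x'F: "x' \<in> F" using x(1) unfolding F_def by simp
    then have "\<phi> x i = \<phi> x' i"
      unfolding \<phi>[OF xX \<open>x' \<in> X\<close>] using i[OF x(1) x'F x'] \<open>\<pi> x = \<pi> x'\<close> by simp
    then show "a \<in> (\<lambda>C. \<phi> (SOME x. x \<in> C) i) ` transition_classes X \<pi> y"
      unfolding classes x(2) x'_def using x(1) by blast
  qed
  moreover have fin: "finite (transition_classes X \<pi> y)" unfolding classes using F by simp
  ultimately have "card {a\<in>alphabet X'. pb' a = \<psi> y i} \<le>
      card ((\<lambda>C. \<phi> (SOME x. x \<in> C) i) ` transition_classes X \<pi> y)"
    by (intro card_mono) auto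
  also have "\<dots> \<le> card (transition_classes X \<pi> y)" using fin by (rule card_image_le)
  finally show thesis using that conj one pb' by blast
qed

theorem proposition5p4:
  fixes X :: "(int \<Rightarrow> 'a) set" and Y :: "(int \<Rightarrow> 'b) set"
    and \<pi> :: "(int \<Rightarrow> 'a) \<Rightarrow> (int \<Rightarrow> 'b)"
    and \<nu> :: "(int \<Rightarrow> 'b) measure" and y :: "int \<Rightarrow> 'b"
  assumes "factor_triple X Y \<pi>"
    and "one_block X \<pi>"
    and "ergodic_measure Y \<nu>"
    and "generic_point Y \<nu> y"
  shows "finite (transition_classes X \<pi> y) \<and>
         card (transition_classes X \<pi> y) \<le> min_N X Y \<pi> \<nu> \<and>
         (finite_to_one X Y \<pi> \<and> fully_supported Y \<nu> \<longrightarrow>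
            card (transition_classes X \<pi> y) = min_N X Y \<pi> \<nu>)"
proof -
  obtain pb where pb: "symbol_map X \<pi> pb" using assms(2) unfolding one_block_def by blast
  have y: "y \<in> Y" using assms(4) unfolding generic_point_def by blast
  have prob: "prob_space \<nu>" and sets: "sets \<nu> = sets (shift_borel Y)"
    using assms(3) unfolding ergodic_measure_def by auto
  have space: "space \<nu> = Y" using sets sets_eq_imp_space_eq space_shift_borel by blast
  have inv: "shift ` Y = Y"
    using assms(1) unfolding factor_triple_def sofic_def shift_space_def by blast
  define S where "S = {N_measure X' Y' (distr \<nu> (shift_borel Y') \<psi>) pb'
          |(X' :: (int \<Rightarrow> nat) set) (Y' :: (int \<Rightarrow> nat) set) \<pi>' pb' \<phi> \<psi>.
             conjugate_triples_via X Y \<pi> X' Y' \<pi>' \<phi> \<psi> \<and>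
             one_step X' \<and> symbol_map X' \<pi>' pb'}"
  have min: "min_N X Y \<pi> \<nu> = Inf S" unfolding min_N_def S_def ..
  obtain L where win: "window_determined L X"
    using assms(1) shift_of_finite_type_window unfolding factor_triple_def by blast
  have "S \<noteq> {}"
    unfolding S_def by (rule higher_block_presentation[OF assms(1) pb win, where m = 0]) blast
  then have "Inf S \<in> S" by (rule Inf_nat_def1)
  then obtain X' Y' :: "(int \<Rightarrow> nat) set" and \<pi>' pb' \<phi> \<psi> where
    conj: "conjugate_triples_via X Y \<pi> X' Y' \<pi>' \<phi> \<psi>" and one: "one_step X'"
    and pb': "symbol_map X' \<pi>' pb'"
    and N: "Inf S = N_measure X' Y' (distr \<nu> (shift_borel Y') \<psi>) pb'"
    unfolding S_def by blast
  have props: "continuous_map (shift_top Y) (shift_top Y') \<psi> \<and> \<psi> ` Y = Y' \<and>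
      (\<forall>z\<in>Y. \<psi> (shift z) = shift (\<psi> z)) \<and> finite (alphabet Y')"
    if "conjugate_triples_via X Y \<pi> X' Y' \<pi>' \<phi> \<psi>"
    for X' Y' :: "(int \<Rightarrow> nat) set" and \<pi>' \<phi> \<psi>
    using that unfolding conjugate_triples_via_def conjugacy_def homeomorphic_eq_everything_map
      factor_triple_def sofic_def shift_space_def by auto
  note \<psi> = props[OF conj]
  have "prob_space (distr \<nu> (shift_borel Y') \<psi>)"
    using \<psi> sets by (intro prob_space.prob_space_distr prob continuous_measurable) auto
  then obtain w where w: "measure (distr \<nu> (shift_borel Y') \<psi>) (cylinder Y' w) > 0"
    and Nw: "N_measure X' Y' (distr \<nu> (shift_borel Y') \<psi>) pb' = card {a\<in>alphabet X'. pb' a = w}"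
    using N_measure_attained[of Y' "distr \<nu> (shift_borel Y') \<psi>" X' pb'] \<psi> by auto
  have "\<exists>\<^sub>F k in sequentially. \<psi> y (int k) = w"
    using generic_recurrent[OF sets inv assms(4) _ _ w] \<psi> by blast
  then have upper: "finite (transition_classes X \<pi> y)"
    "card (transition_classes X \<pi> y) \<le> min_N X Y \<pi> \<nu>"
    using card_transition_classes_le[OF conj one pb' pb] unfolding min N Nw by auto
  have "min_N X Y \<pi> \<nu> \<le> card (transition_classes X \<pi> y)"
    if fto: "finite_to_one X Y \<pi>" and full: "fully_supported Y \<nu>"
  proof -
    obtain X' Y' :: "(int \<Rightarrow> nat) set" and \<pi>' pb' \<phi> \<psi> i where
      conj: "conjugate_triples_via X Y \<pi> X' Y' \<pi>' \<phi> \<psi>" and one: "one_step X'"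
      and pb': "symbol_map X' \<pi>' pb'"
      and le: "card {a\<in>alphabet X'. pb' a = \<psi> y i} \<le> card (transition_classes X \<pi> y)"
      by (rule presentation_with_class_many_symbols[OF assms(1) pb fto y]) blast
    note \<psi> = props[OF conj]
    \<comment> \<open>The symbol of \<open>\<psi> y\<close> at \<open>i\<close> has positive measure: its cylinder pulls back to an open set
      that contains the translate of \<open>y\<close> by \<open>i\<close>.\<close>
    define A where "A = \<psi> -` cylinder Y' (\<psi> y i) \<inter> Y"
    have "A = {z\<in>topspace (shift_top Y). \<psi> z \<in> cylinder Y' (\<psi> y i)}" unfolding A_def by auto
    then have "openin (shift_top Y) A"
      using openin_continuous_map_preimage[OF conjunct1[OF \<psi>] openin_cylinder] by simp
    moreover have "(\<lambda>j. y (j + i)) \<in> A"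
    proof -
      have yi: "(\<lambda>j. y (j + i)) \<in> Y" by (rule translate_mem[OF inv y])
      have "\<psi> (\<lambda>j. y (j + i)) = (\<lambda>j. \<psi> y (j + i))"
        by (rule translate_commute[of Y, OF inv _ y]) (use \<psi> in blast)
      moreover have "\<psi> (\<lambda>j. y (j + i)) \<in> Y'" using \<psi> yi by blast
      ultimately show ?thesis unfolding A_def cylinder_def using yi by simp
    qed
    ultimately have "measure \<nu> A > 0" using full unfolding fully_supported_def by blast
    moreover have "measure (distr \<nu> (shift_borel Y') \<psi>) (cylinder Y' (\<psi> y i)) = measure \<nu> A"
      unfolding A_def space[symmetric]
      by (intro measure_distr continuous_measurable[OF conjunct1[OF \<psi>] sets]
          openin_sets_shift_borel openin_cylinder)
    moreover have "\<psi> y i \<in> alphabet Y'" unfolding alphabet_def using \<psi> y by blast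
    ultimately have "N_measure X' Y' (distr \<nu> (shift_borel Y') \<psi>) pb'
        \<le> card {a\<in>alphabet X'. pb' a = \<psi> y i}"
      using \<psi> by (intro N_measure_le) auto
    moreover have "N_measure X' Y' (distr \<nu> (shift_borel Y') \<psi>) pb' \<in> S"
      unfolding S_def using conj one pb' by blast
    then have "Inf S \<le> N_measure X' Y' (distr \<nu> (shift_borel Y') \<psi>) pb'"
      by (rule cInf_lower) simp
    ultimately show ?thesis using le min by linarith
  qed
  with upper show ?thesis by (metis order_antisym)
qed

end
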